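(* If there exists a polynomial-time algorithm which, given agents, objects, additive utilities and an initial endowment $e$, computes an assignment that is Pareto optimal and individually rational for $e$, then there exists a polynomial-time algorithm which, given agents, objects, additive utilities and an assignment $p$, decides whether $p$ is Pareto optimal.
   Context: $N=\{1,\dots,n\}$ is a set of agents and $O=\{o_1,\dots,o_m\}$ a set of objects. An assignment $p=(p(1),\dots,p(n))$ is a partition of $O$ into $n$ (possibly empty) subsets, $p(i)$ being the bundle of agent $i$; an initial endowment $e$ is an assignment. Each agent $i$ has a utility $u_i(o)\ge 0$ (a rational number) for each object, extended additively: $u_i(S)=\sum_{o\in S}u_i(o)$ for $S\subseteq O$. An assignment $p$ is individually rational for $e$ if $u_i(p(i))\ge u_i(e(i))$ for all $i$. Assignment $q$ Pareto dominates $p$ if $u_i(q(i))\ge u_i(p(i))$ for all $i\in N$ and $u_i(q(i))>u_i(p(i))$ for at least one $i\in N$. An assignment is Pareto optimal if no assignment Pareto dominates it. *)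

theory Defs
  imports
    Complex_Main
    "HOL-Library.Disjoint_Sets"
    "HOL-Computational_Algebra.Polynomial"
begin

section \<open>Assignment of objects to agents\<close>

text \<open>
  Agents are the numbers \<open>1, ..., n\<close>, and the object \<open>o\<^sub>j\<close> is represented by its index \<open>j\<close>.
  An assignment is a function from agents to bundles; only its values on the agents matter, and
  likewise only the utilities of agents for objects matter.
\<close>

record market =
  num_agents :: nat
  num_objects :: nat
  util :: "nat \<Rightarrow> nat \<Rightarrow> rat"

definition agents :: "market \<Rightarrow> nat set" where
  "agents I = {1..num_agents I}"

definition objects :: "market \<Rightarrow> nat set" where
  "objects I = {1..num_objects I}"

definition wf_market :: "market \<Rightarrow> bool" where
  "wf_market I \<longleftrightarrow> (\<forall>i\<in>agents I. \<forall>j\<in>objects I. 0 \<le> util I i j)"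

definition bundle_util :: "market \<Rightarrow> nat \<Rightarrow> nat set \<Rightarrow> rat" where
  "bundle_util I i S = (\<Sum>j\<in>S. util I i j)"

definition assignment :: "market \<Rightarrow> (nat \<Rightarrow> nat set) \<Rightarrow> bool" where
  "assignment I p \<longleftrightarrow>
     disjoint_family_on p (agents I) \<and> (\<Union>i\<in>agents I. p i) = objects I"

definition individually_rational ::
    "market \<Rightarrow> (nat \<Rightarrow> nat set) \<Rightarrow> (nat \<Rightarrow> nat set) \<Rightarrow> bool" where
  "individually_rational I e p \<longleftrightarrow>
     (\<forall>i\<in>agents I. bundle_util I i (p i) \<ge> bundle_util I i (e i))"

definition pareto_dominates ::
    "market \<Rightarrow> (nat \<Rightarrow> nat set) \<Rightarrow> (nat \<Rightarrow> nat set) \<Rightarrow> bool" where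
  "pareto_dominates I q p \<longleftrightarrow>
     (\<forall>i\<in>agents I. bundle_util I i (q i) \<ge> bundle_util I i (p i)) \<and>
     (\<exists>i\<in>agents I. bundle_util I i (q i) > bundle_util I i (p i))"

definition pareto_optimal :: "market \<Rightarrow> (nat \<Rightarrow> nat set) \<Rightarrow> bool" where
  "pareto_optimal I p \<longleftrightarrow> \<not> (\<exists>q. assignment I q \<and> pareto_dominates I q p)"


section \<open>Polynomial-time computation\<close>

text \<open>
  Deterministic multi-tape Turing machines with two-way infinite tapes.  Tape symbols are the
  numbers below \<open>num_symbols\<close>, where \<open>0\<close> is the blank; states are the numbers below
  \<open>num_states\<close>.  In state \<open>s\<close> reading the symbols \<open>xs\<close> (one per tape), \<open>delta s xs\<close> gives the
  next state and, for each tape, the symbol to write and the head movement.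
\<close>

datatype move = Left | Stay | Right

record tm =
  num_tapes :: nat
  num_symbols :: nat
  num_states :: nat
  start_state :: nat
  halt_state :: nat
  delta :: "nat \<Rightarrow> nat list \<Rightarrow> nat \<times> (nat \<times> move) list"

definition wf_tm :: "tm \<Rightarrow> bool" where
  "wf_tm M \<longleftrightarrow>
     0 < num_tapes M \<and> 0 < num_symbols M \<and>
     start_state M < num_states M \<and> halt_state M < num_states M \<and>
     (\<forall>s xs s' acts.
        s < num_states M \<and> length xs = num_tapes M \<and> set xs \<subseteq> {..<num_symbols M} \<and>
        delta M s xs = (s', acts) \<longrightarrow>
          s' < num_states M \<and> length acts = num_tapes M \<and> fst ` set acts \<subseteq> {..<num_symbols M})"

text \<open>A tape is given by its contents together with the position of its head.\<close>

type_synonym tape = "(int \<Rightarrow> nat) \<times> int"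

type_synonym config = "nat \<times> tape list"

fun tape_read :: "tape \<Rightarrow> nat" where
  "tape_read (t, h) = t h"

fun offset :: "move \<Rightarrow> int" where
  "offset Left = -1"
| "offset Stay = 0"
| "offset Right = 1"

fun tape_act :: "nat \<times> move \<Rightarrow> tape \<Rightarrow> tape" where
  "tape_act (a, d) (t, h) = (t(h := a), h + offset d)"

text \<open>The halting state is absorbing, so ``halted after exactly \<open>k\<close> steps of the iterated step
  function'' means ``halts within \<open>k\<close> steps''.\<close>

fun tm_step :: "tm \<Rightarrow> config \<Rightarrow> config" where
  "tm_step M (s, ts) =
     (if s = halt_state M then (s, ts)
      else let (s', acts) = delta M s (map tape_read ts) in (s', map2 tape_act acts ts))"

definition blank_tape :: tape where
  "blank_tape = ((\<lambda>_. 0), 0)"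

definition input_tape :: "nat list \<Rightarrow> tape" where
  "input_tape w = ((\<lambda>z. if 0 \<le> z \<and> z < int (length w) then w ! nat z else 0), 0)"

definition init_config :: "tm \<Rightarrow> nat list \<Rightarrow> config" where
  "init_config M w = (start_state M, input_tape w # replicate (num_tapes M - 1) blank_tape)"

text \<open>The output is read off the last tape, from the head to the right up to the first blank.\<close>

fun tape_output :: "tape \<Rightarrow> nat list \<Rightarrow> bool" where
  "tape_output (t, h) w \<longleftrightarrow>
     (\<forall>j<length w. t (h + int j) = w ! j \<and> w ! j \<noteq> 0) \<and> t (h + int (length w)) = 0"

definition tm_outputs_within :: "tm \<Rightarrow> nat list \<Rightarrow> nat \<Rightarrow> nat list \<Rightarrow> bool" where
  "tm_outputs_within M w k v \<longleftrightarrow>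
     (case (tm_step M ^^ k) (init_config M w) of
        (s, ts) \<Rightarrow> s = halt_state M \<and> tape_output (last ts) v)"

text \<open>
  Existence of a polynomial-time algorithm that, given any instance \<open>x\<close> from \<open>X\<close>, computes some
  \<open>y\<close> with \<open>R x y\<close>.  Instances are encoded by \<open>enc\<close>, and a result \<open>y\<close> for the instance \<open>x\<close> by
  \<open>enc_out x y\<close>.
\<close>

definition poly_time_computable ::
    "'a set \<Rightarrow> ('a \<Rightarrow> nat list) \<Rightarrow> ('a \<Rightarrow> 'b \<Rightarrow> nat list) \<Rightarrow> ('a \<Rightarrow> 'b \<Rightarrow> bool) \<Rightarrow> bool" where
  "poly_time_computable X enc enc_out R \<longleftrightarrow>
     (\<exists>(M :: tm) (b :: nat poly). wf_tm M \<and>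
        (\<forall>x\<in>X. set (enc x) \<subseteq> {0<..<num_symbols M} \<and>
           (\<exists>y. R x y \<and> tm_outputs_within M (enc x) (poly b (length (enc x))) (enc_out x y))))"


section \<open>Encodings\<close>

abbreviation sym_zero :: nat where "sym_zero \<equiv> 1"
abbreviation sym_one :: nat where "sym_one \<equiv> 2"
abbreviation sym_slash :: nat where "sym_slash \<equiv> 3"
abbreviation sym_comma :: nat where "sym_comma \<equiv> 4"
abbreviation sym_semicolon :: nat where "sym_semicolon \<equiv> 5"
abbreviation sym_hash :: nat where "sym_hash \<equiv> 6"

definition enc_bool :: "bool \<Rightarrow> nat list" where
  "enc_bool b = [if b then sym_one else sym_zero]"

text \<open>Binary representation, least significant bit first, with \<open>0\<close> represented by \<open>[]\<close>.\<close>

fun enc_nat :: "nat \<Rightarrow> nat list" where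
  "enc_nat n = (if n = 0 then [] else enc_bool (odd n) @ enc_nat (n div 2))"

declare enc_nat.simps [simp del]

text \<open>Nonnegative rationals, as fractions in lowest terms.\<close>

definition enc_rat :: "rat \<Rightarrow> nat list" where
  "enc_rat r = (case quotient_of r of (a, b) \<Rightarrow> enc_nat (nat a) @ [sym_slash] @ enc_nat (nat b))"

text \<open>The matrix of utilities, with one row for each agent and one entry for each object.\<close>

definition enc_market :: "market \<Rightarrow> nat list" where
  "enc_market I =
     concat (map (\<lambda>i.
       concat (map (\<lambda>j. enc_rat (util I i j) @ [sym_comma]) [1..<num_objects I + 1])
         @ [sym_semicolon]) [1..<num_agents I + 1])"

text \<open>The bundles of the agents, each given by its characteristic vector.\<close>

definition enc_assignment :: "market \<Rightarrow> (nat \<Rightarrow> nat set) \<Rightarrow> nat list" where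
  "enc_assignment I p =
     concat (map (\<lambda>i.
       concat (map (\<lambda>j. enc_bool (j \<in> p i)) [1..<num_objects I + 1])
         @ [sym_semicolon]) [1..<num_agents I + 1])"

definition enc_instance :: "market \<times> (nat \<Rightarrow> nat set) \<Rightarrow> nat list" where
  "enc_instance = (\<lambda>(I, p). enc_market I @ [sym_hash] @ enc_assignment I p)"

definition instances :: "(market \<times> (nat \<Rightarrow> nat set)) set" where
  "instances = {(I, p). wf_market I \<and> assignment I p}"

definition poly_time_decidable :: "'a set \<Rightarrow> ('a \<Rightarrow> nat list) \<Rightarrow> ('a \<Rightarrow> bool) \<Rightarrow> bool" where
  "poly_time_decidable X enc P \<longleftrightarrow>
     poly_time_computable X enc (\<lambda>_. enc_bool) (\<lambda>x b. b \<longleftrightarrow> P x)"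

end

theory Submission
  imports Defs
begin

text \<open>
  Give the assignment \<open>p\<close> to the assumed algorithm as the endowment.  Its answer \<open>q\<close> is Pareto optimal
  and nobody is worse off under \<open>q\<close> than under \<open>p\<close>, so \<open>p\<close> is Pareto optimal if and only if
  everybody is indifferent between \<open>p\<close> and \<open>q\<close>.  To test the latter for agent \<open>i\<close>, a machine
  maintains the values of the two bundles as fractions \<open>P / D\<close> and \<open>Q / D\<close> in binary; adding the
  utility \<open>a / b\<close> of an object amounts to \<open>P := b * P + a * D\<close> and \<open>D := b * D\<close>.  With the encoding
  read backwards the digits of \<open>b\<close> and \<open>a\<close> arrive with the most significant one first, so the
  products are computed by Horner's scheme, and all numbers stay as short as the input up to a
  constant factor.  The machine is obtained by compiling a program over stacks, each stack being kept
  on a tape of its own.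
\<close>

section \<open>Composing Turing machines\<close>

text \<open>One denominator serves both bundles of an agent, so indifference is equality of
  numerators, and neither reduction nor division of fractions occurs. Horner's scheme wants the most
  significant digit first, while doubling and addition want the least significant digit on top of a
  stack, where doubling is a single push; reading backwards reconciles the two. Each digit read
  lengthens a number by at most two, so every digit of the input causes linear work and the check
  takes quadratic time.

  The obstacle is how little is known about the assumed machine: its run is given only from its
  exact initial tapes, and of the result only the word between the head of the last tape and the
  next blank. It may also destroy its input, so the instance is copied beforehand. After copying,
  its tapes have to be restored cell by cell, whereas after its run garbage has to be tolerated;
  therefore stacks are tied to tapes in an exact and in a loose form.\<close>

definition stay :: "nat list \<Rightarrow> (nat \<times> move) list" where
  "stay xs = map (\<lambda>x. (x, Stay)) xs"

text \<open>\<open>wf_tm\<close> restricts \<open>delta\<close> only on symbol lists of the right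
  length over the alphabet. Nothing is known about a step unless both are secured, so they are
  carried along as an invariant.\<close>

definition valid_tapes :: "nat \<Rightarrow> nat \<Rightarrow> tape list \<Rightarrow> bool" where
  "valid_tapes k n ts \<longleftrightarrow> length ts = k \<and> (\<forall>t\<in>set ts. \<forall>z. fst t z < n)"

text \<open>A bound instead of an exact count: inside a larger machine a part may reach its halting
  state early, and the larger machine then moves on instead of idling.\<close>

definition steps :: "tm \<Rightarrow> nat \<Rightarrow> config \<Rightarrow> config \<Rightarrow> bool" where
  "steps M k c c' \<longleftrightarrow> (\<exists>j\<le>k. (tm_step M ^^ j) c = c')"

definition runs :: "tm \<Rightarrow> nat \<Rightarrow> tape list \<Rightarrow> tape list \<Rightarrow> bool" where
  "runs M k ts ts' \<longleftrightarrow> steps M k (start_state M, ts) (halt_state M, ts')"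

definition fits :: "nat \<Rightarrow> nat \<Rightarrow> tm \<Rightarrow> bool" where
  "fits k n M \<longleftrightarrow> wf_tm M \<and> num_tapes M = k \<and> num_symbols M = n"

lemma fitsD:
  assumes "fits k n M"
  shows "num_tapes M = k" "0 < k" "0 < n" "start_state M < num_states M" "halt_state M < num_states M"
    "num_symbols M = n"
  using assms by (auto simp: fits_def wf_tm_def)

lemma fits_delta:
  assumes "fits k n M" "s < num_states M" "length xs = k" "set xs \<subseteq> {..<n}"
    "delta M s xs = (s', acts)"
  shows "s' < num_states M" "length acts = k" "\<forall>a\<in>set acts. fst a < n"
proof -
  have "s' < num_states M \<and> length acts = k \<and> fst ` set acts \<subseteq> {..<n}"
    using assms unfolding fits_def wf_tm_def by metis
  then show "s' < num_states M" "length acts = k" "\<forall>a\<in>set acts. fst a < n" by auto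
qed

lemma fitsI:
  assumes "num_tapes M = k" "num_symbols M = n" "0 < k" "0 < n"
    "start_state M < num_states M" "halt_state M < num_states M"
    "\<And>s xs s' acts. s < num_states M \<Longrightarrow> length xs = k \<Longrightarrow> set xs \<subseteq> {..<n} \<Longrightarrow>
       delta M s xs = (s', acts) \<Longrightarrow>
       s' < num_states M \<and> length acts = k \<and> (\<forall>a\<in>set acts. fst a < n)"
  shows "fits k n M"
proof -
  have "s' < num_states M \<and> length acts = k \<and> fst ` set acts \<subseteq> {..<n}"
    if "s < num_states M" "length xs = k" "set xs \<subseteq> {..<n}" "delta M s xs = (s', acts)"
    for s xs s' acts
    using assms(7) [OF that] by auto
  then show ?thesis using assms(1-6) unfolding fits_def wf_tm_def by blast
qed

lemma length_stay [simp]: "length (stay xs) = length xs"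
  by (simp add: stay_def)

lemma in_set_stay [simp]: "a \<in> set (stay xs) \<longleftrightarrow> fst a \<in> set xs \<and> snd a = Stay"
  by (cases a) (auto simp: stay_def)

lemma tape_act_stay [simp]: "tape_act (tape_read t, Stay) t = t"
  by (cases t) auto

lemma map2_stay [simp]: "map2 tape_act (stay (map tape_read ts)) ts = ts"
  by (induction ts) (auto simp: stay_def)

lemma map2_stay_update:
  assumes "j < length ts"
  shows "map2 tape_act ((stay (map tape_read ts))[j := (a, d)]) ts = ts[j := tape_act (a, d) (ts ! j)]"
  using assms by (intro nth_equalityI) (auto simp: nth_list_update stay_def)

lemma stay_update_symbols:
  "c \<in> set ((stay xs)[j := (a, d)]) \<Longrightarrow> fst c = a \<or> fst c \<in> set xs"
  using set_update_subset_insert [of "stay xs" j "(a, d)"] by auto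

section \<open>Calculus of bounded runs\<close>

lemma steps_refl: "steps M k c c"
  unfolding steps_def by (rule exI [of _ 0]) simp

lemma steps_mono: "steps M k c c' \<Longrightarrow> k \<le> k' \<Longrightarrow> steps M k' c c'"
  unfolding steps_def using le_trans by blast

lemma steps_trans:
  assumes "steps M k c c'" "steps M l c' c''"
  shows "steps M (k + l) c c''"
proof -
  obtain i j where ij: "i \<le> k" "(tm_step M ^^ i) c = c'" "j \<le> l" "(tm_step M ^^ j) c' = c''"
    using assms by (auto simp: steps_def)
  have "(tm_step M ^^ (j + i)) c = c''" using ij by (simp add: funpow_add)
  then show ?thesis using ij unfolding steps_def by (intro exI [of _ "j + i"]) simp
qed

lemma steps_Suc: "steps M k (tm_step M c) c' \<Longrightarrow> steps M (Suc k) c c'"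
proof -
  assume "steps M k (tm_step M c) c'"
  then obtain j where "j \<le> k" "(tm_step M ^^ j) (tm_step M c) = c'" by (auto simp: steps_def)
  then show ?thesis
    unfolding steps_def by (intro exI [of _ "Suc j"]) (simp add: funpow_swap1)
qed

lemma runs_mono: "runs M k ts ts' \<Longrightarrow> k \<le> k' \<Longrightarrow> runs M k' ts ts'"
  unfolding runs_def by (rule steps_mono)

lemma funpow_tm_step_halt [simp]: "(tm_step M ^^ k) (halt_state M, ts) = (halt_state M, ts)"
  by (induction k) auto

text \<open>The halting state is absorbing, so idling makes up the difference between bound and
  actual count. This is the form in which \<open>tm_outputs_within\<close> counts.\<close>

lemma runs_iff: "runs M k ts ts' \<longleftrightarrow> (tm_step M ^^ k) (start_state M, ts) = (halt_state M, ts')"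
proof
  assume "runs M k ts ts'"
  then obtain j where j: "j \<le> k" "(tm_step M ^^ j) (start_state M, ts) = (halt_state M, ts')"
    by (auto simp: runs_def steps_def)
  have "(tm_step M ^^ (k - j + j)) (start_state M, ts) = (halt_state M, ts')"
    unfolding funpow_add using j by simp
  then show "(tm_step M ^^ k) (start_state M, ts) = (halt_state M, ts')" using j by simp
qed (auto simp: runs_def steps_def)

lemma fst_tape_act_less:
  assumes "\<forall>z. fst t z < n" "a < n"
  shows "fst (tape_act (a, d) t) z < n"
  using assms by (cases t) auto

lemma tape_read_less: "valid_tapes k n ts \<Longrightarrow> set (map tape_read ts) \<subseteq> {..<n}"
  unfolding valid_tapes_def by (auto; metis fst_conv tape_read.elims)

lemma valid_tapes_act:
  assumes "valid_tapes k n ts" "length acts = k" "\<forall>a\<in>set acts. fst a < n"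
  shows "valid_tapes k n (map2 tape_act acts ts)"
  unfolding valid_tapes_def
proof (intro conjI ballI allI)
  show "length (map2 tape_act acts ts) = k" using assms by (simp add: valid_tapes_def)
next
  fix t' z
  assume "t' \<in> set (map2 tape_act acts ts)"
  then obtain a d t where t: "t' = tape_act (a, d) t" "(a, d) \<in> set acts" "t \<in> set ts"
    by (force dest: set_zip_leftD set_zip_rightD)
  then have "a < n" using assms(3) by force
  then show "fst t' z < n" using t assms(1) fst_tape_act_less unfolding valid_tapes_def by metis
qed

lemma tm_step_valid:
  assumes "fits k n M" "s < num_states M" "valid_tapes k n ts" "tm_step M (s, ts) = (s', ts')"
  shows "s' < num_states M \<and> valid_tapes k n ts'"
proof (cases "s = halt_state M")
  case False
  obtain s1 acts where d: "delta M s (map tape_read ts) = (s1, acts)" by force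
  have eq: "s' = s1" "ts' = map2 tape_act acts ts" using assms(4) False d by auto
  have "length (map tape_read ts) = k" "set (map tape_read ts) \<subseteq> {..<n}"
    using assms(3) tape_read_less by (auto simp: valid_tapes_def)
  note fits_delta [OF assms(1,2) this d]
  with valid_tapes_act [OF assms(3)] show ?thesis by (simp add: eq)
qed (use assms in auto)

lemma funpow_tm_step_valid:
  assumes "fits k n M" "s < num_states M" "valid_tapes k n ts"
  shows "(tm_step M ^^ j) (s, ts) = (s', ts') \<Longrightarrow> s' < num_states M \<and> valid_tapes k n ts'"
proof (induction j arbitrary: s' ts')
  case 0
  then show ?case using assms by simp
next
  case (Suc j)
  obtain s1 ts1 where "(tm_step M ^^ j) (s, ts) = (s1, ts1)" by force
  moreover from this have "s1 < num_states M" "valid_tapes k n ts1" using Suc.IH by blast+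
  moreover have "tm_step M (s1, ts1) = (s', ts')" using Suc.prems calculation(1) by simp
  ultimately show ?case using tm_step_valid [OF assms(1)] by blast
qed

lemma runs_valid:
  assumes "fits k n M" "valid_tapes k n ts" "runs M j ts ts'"
  shows "valid_tapes k n ts'"
  using funpow_tm_step_valid [OF assms(1) _ assms(2), of "start_state M"] assms
  unfolding runs_iff by (auto simp: fits_def wf_tm_def)

text \<open>A copy of \<open>M\<close> inside \<open>N\<close> occupying the states from \<open>off\<close> on, except that \<open>N\<close> may
  continue where \<open>M\<close> halts.\<close>

definition embeds :: "nat \<Rightarrow> tm \<Rightarrow> tm \<Rightarrow> bool" where
  "embeds off M N \<longleftrightarrow>
     (\<forall>s<num_states M. s \<noteq> halt_state M \<longrightarrow> off + s \<noteq> halt_state N \<and>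
        (\<forall>xs. delta N (off + s) xs = (let (s', acts) = delta M s xs in (off + s', acts))))"

lemma embeds_steps:
  assumes "embeds off M N" "fits k n M"
  shows "s < num_states M \<Longrightarrow> valid_tapes k n ts \<Longrightarrow>
     (tm_step M ^^ j) (s, ts) = (halt_state M, ts') \<Longrightarrow>
     steps N j (off + s, ts) (off + halt_state M, ts')"
proof (induction j arbitrary: s ts)
  case 0
  then show ?case by (simp add: steps_refl)
next
  case (Suc j)
  show ?case
  proof (cases "s = halt_state M")
    case True
    \<comment> \<open>\<open>M\<close> idles from here on, but \<open>N\<close> may leave this
      state, so zero steps of \<open>N\<close> are counted.\<close>
    then show ?thesis using Suc.prems funpow_tm_step_halt [of "Suc j" M ts]
      by (metis Pair_inject steps_refl)
  next
    case False
    obtain s1 ts1 where st: "tm_step M (s, ts) = (s1, ts1)" by force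
    have "s1 < num_states M \<and> valid_tapes k n ts1"
      using tm_step_valid [OF assms(2) Suc.prems(1,2) st] .
    moreover have "(tm_step M ^^ j) (s1, ts1) = (halt_state M, ts')"
      using Suc.prems(3) st by (simp add: funpow_swap1)
    ultimately have IH: "steps N j (off + s1, ts1) (off + halt_state M, ts')"
      using Suc.IH by blast
    have "tm_step N (off + s, ts) = (off + s1, ts1)"
      using assms(1) Suc.prems(1) False st unfolding embeds_def
      by (auto simp: Let_def split: prod.splits)
    then show ?thesis using IH steps_Suc by metis
  qed
qed

lemma embeds_runs:
  assumes "embeds off M N" "fits k n M" "valid_tapes k n ts" "runs M j ts ts'"
  shows "steps N j (off + start_state M, ts) (off + halt_state M, ts')"
  using embeds_steps [OF assms(1,2) _ assms(3)] assms(2,4)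
  by (auto simp: runs_iff fits_def wf_tm_def)

text \<open>The halting state of \<open>M\<close> becomes a transition to the start of
  \<open>N\<close>; this is the additional step in the running time of a composition.\<close>

definition seq_tm :: "tm \<Rightarrow> tm \<Rightarrow> tm" where
  "seq_tm M N = \<lparr> num_tapes = num_tapes M, num_symbols = num_symbols M,
     num_states = num_states M + num_states N, start_state = start_state M,
     halt_state = num_states M + halt_state N,
     delta = (\<lambda>s xs.
       if s = halt_state M then (num_states M + start_state N, stay xs)
       else if s < num_states M then delta M s xs
       else let (s', acts) = delta N (s - num_states M) xs in (num_states M + s', acts)) \<rparr>"

text \<open>One new state evaluates the test on the symbols under the heads, the other is the common
  exit; entering and leaving a branch cost one step each.\<close>

definition cond_tm :: "(nat list \<Rightarrow> bool) \<Rightarrow> tm \<Rightarrow> tm \<Rightarrow> tm" where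
  "cond_tm b M N = \<lparr> num_tapes = num_tapes M, num_symbols = num_symbols M,
     num_states = num_states M + num_states N + 2, start_state = num_states M + num_states N,
     halt_state = num_states M + num_states N + 1,
     delta = (\<lambda>s xs.
       if s = num_states M + num_states N
         then (if b xs then start_state M else num_states M + start_state N, stay xs)
       else if s = halt_state M \<or> s = num_states M + halt_state N
         then (num_states M + num_states N + 1, stay xs)
       else if s < num_states M then delta M s xs
       else if s < num_states M + num_states N
         then let (s', acts) = delta N (s - num_states M) xs in (num_states M + s', acts)
       else (s, stay xs)) \<rparr>"

text \<open>The halting state of the body returns to the state of the test. A failed test costs one
  step, and each iteration two in addition to the body.\<close>

definition while_tm :: "(nat list \<Rightarrow> bool) \<Rightarrow> tm \<Rightarrow> tm" where
  "while_tm b M = \<lparr> num_tapes = num_tapes M, num_symbols = num_symbols M,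
     num_states = num_states M + 2, start_state = num_states M,
     halt_state = num_states M + 1,
     delta = (\<lambda>s xs.
       if s = num_states M then (if b xs then start_state M else num_states M + 1, stay xs)
       else if s = halt_state M then (num_states M, stay xs)
       else if s < num_states M then delta M s xs
       else (s, stay xs)) \<rparr>"

lemma fits_seq_tm:
  assumes "fits k n M" "fits k n N"
  shows "fits k n (seq_tm M N)"
proof (rule fitsI)
  fix s xs s' acts
  assume s: "s < num_states (seq_tm M N)" "length xs = k" "set xs \<subseteq> {..<n}"
    "delta (seq_tm M N) s xs = (s', acts)"
  consider "s = halt_state M" | "s \<noteq> halt_state M" "s < num_states M" | "s \<noteq> halt_state M" "s \<ge> num_states M"
    by linarith
  then show "s' < num_states (seq_tm M N) \<and> length acts = k \<and> (\<forall>a\<in>set acts. fst a < n)"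
  proof cases
    case 1
    then show ?thesis using s fitsD(4) [OF assms(2)] by (auto simp: seq_tm_def)
  next
    case 2
    then show ?thesis using s fits_delta [OF assms(1), of s xs s' acts] by (auto simp: seq_tm_def)
  next
    case 3
    then obtain s1 where "delta N (s - num_states M) xs = (s1, acts)" "s' = num_states M + s1"
      using s by (auto simp: seq_tm_def split: prod.splits)
    then show ?thesis using 3 s fits_delta [OF assms(2), of "s - num_states M" xs s1 acts]
      by (auto simp: seq_tm_def)
  qed
qed (use fitsD [OF assms(1)] fitsD [OF assms(2)] in \<open>simp_all add: seq_tm_def\<close>)

lemma fits_cond_tm:
  assumes "fits k n M" "fits k n N"
  shows "fits k n (cond_tm b M N)"
proof (rule fitsI)
  fix s xs s' acts
  assume s: "s < num_states (cond_tm b M N)" "length xs = k" "set xs \<subseteq> {..<n}"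
    "delta (cond_tm b M N) s xs = (s', acts)"
  consider "s = num_states M + num_states N \<or> s = num_states M + num_states N + 1 \<or>
      s = halt_state M \<or> s = num_states M + halt_state N"
    | "s \<noteq> halt_state M" "s < num_states M"
    | "s \<ge> num_states M" "s < num_states M + num_states N" "s \<noteq> num_states M + halt_state N"
    using s by (fastforce simp: cond_tm_def)
  then show "s' < num_states (cond_tm b M N) \<and> length acts = k \<and> (\<forall>a\<in>set acts. fst a < n)"
  proof cases
    case 1
    then show ?thesis using s fitsD(4,5) [OF assms(1)] fitsD(4,5) [OF assms(2)]
      by (auto simp: cond_tm_def split: if_splits)
  next
    case 2
    then show ?thesis using s fits_delta [OF assms(1), of s xs s' acts]
      by (auto simp: cond_tm_def)
  next
    case 3
    then obtain s1 where "delta N (s - num_states M) xs = (s1, acts)" "s' = num_states M + s1"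
      using s fitsD(5) [OF assms(1)] by (auto simp: cond_tm_def split: prod.splits)
    moreover have "s - num_states M < num_states N" using 3 by linarith
    ultimately show ?thesis using s fits_delta [OF assms(2), of "s - num_states M" xs s1 acts]
      by (simp add: cond_tm_def)
  qed
qed (use fitsD [OF assms(1)] fitsD [OF assms(2)] in \<open>simp_all add: cond_tm_def\<close>)

lemma fits_while_tm:
  assumes "fits k n M"
  shows "fits k n (while_tm b M)"
proof (rule fitsI)
  fix s xs s' acts
  assume s: "s < num_states (while_tm b M)" "length xs = k" "set xs \<subseteq> {..<n}"
    "delta (while_tm b M) s xs = (s', acts)"
  consider "s = num_states M \<or> s = num_states M + 1 \<or> s = halt_state M"
    | "s \<noteq> halt_state M" "s < num_states M"
    using s by (fastforce simp: while_tm_def)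
  then show "s' < num_states (while_tm b M) \<and> length acts = k \<and> (\<forall>a\<in>set acts. fst a < n)"
  proof cases
    case 1
    then show ?thesis using s fitsD(4,5) [OF assms(1)]
      by (auto simp: while_tm_def split: if_splits)
  next
    case 2
    then show ?thesis using s fits_delta [OF assms(1), of s xs s' acts]
      by (auto simp: while_tm_def)
  qed
qed (use fitsD [OF assms(1)] in \<open>simp_all add: while_tm_def\<close>)

lemma runs_seq_tm:
  assumes fits: "fits k n M" "fits k n N" and ts: "valid_tapes k n ts"
    and M: "runs M i ts ts'" and N: "runs N j ts' ts''"
  shows "runs (seq_tm M N) (i + j + 1) ts ts''"
proof -
  have h: "halt_state M < num_states M" using fits by (auto simp: fits_def wf_tm_def)
  have "embeds 0 M (seq_tm M N)" "embeds (num_states M) N (seq_tm M N)"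
    using h by (auto simp: embeds_def seq_tm_def split: prod.splits)
  then have 1: "steps (seq_tm M N) i (start_state M, ts) (halt_state M, ts')"
    and 2: "steps (seq_tm M N) j (num_states M + start_state N, ts') (num_states M + halt_state N, ts'')"
    using embeds_runs fits ts M N runs_valid [OF fits(1) ts M] by fastforce+
  have "tm_step (seq_tm M N) (halt_state M, ts') = (num_states M + start_state N, ts')"
    using h by (simp add: seq_tm_def)
  then have "steps (seq_tm M N) (Suc j) (halt_state M, ts') (num_states M + halt_state N, ts'')"
    using 2 steps_Suc by metis
  from steps_trans [OF 1 this] show ?thesis by (simp add: runs_def seq_tm_def)
qed

lemma runs_cond_tm:
  assumes fits: "fits k n M" "fits k n N" and ts: "valid_tapes k n ts"
    and run: "runs (if b (map tape_read ts) then M else N) j ts ts'"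
  shows "runs (cond_tm b M N) (j + 2) ts ts'"
proof -
  note h = fitsD(4,5) [OF fits(1)] fitsD(4,5) [OF fits(2)]
  let ?C = "cond_tm b M N"
  have e: "embeds 0 M ?C" "embeds (num_states M) N ?C"
    using h by (auto simp: embeds_def cond_tm_def split: prod.splits)
  have "\<exists>s s'. tm_step ?C (start_state ?C, ts) = (s, ts) \<and> steps ?C j (s, ts) (s', ts') \<and>
      tm_step ?C (s', ts') = (halt_state ?C, ts')"
  proof (cases "b (map tape_read ts)")
    case True
    then have "steps ?C j (start_state M, ts) (halt_state M, ts')"
      using embeds_runs [OF e(1) fits(1) ts] run by simp
    moreover have "tm_step ?C (start_state ?C, ts) = (start_state M, ts)"
      "tm_step ?C (halt_state M, ts') = (halt_state ?C, ts')"
      using h True by (simp_all add: cond_tm_def)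
    ultimately show ?thesis by blast
  next
    case False
    then have "steps ?C j (num_states M + start_state N, ts) (num_states M + halt_state N, ts')"
      using embeds_runs [OF e(2) fits(2) ts] run by simp
    moreover have "tm_step ?C (start_state ?C, ts) = (num_states M + start_state N, ts)"
      "tm_step ?C (num_states M + halt_state N, ts') = (halt_state ?C, ts')"
      using h False by (simp_all add: cond_tm_def)
    ultimately show ?thesis by blast
  qed
  then obtain s s' where ss: "tm_step ?C (start_state ?C, ts) = (s, ts)"
    "steps ?C j (s, ts) (s', ts')" "tm_step ?C (s', ts') = (halt_state ?C, ts')" by blast
  have "steps ?C 1 (s', ts') (halt_state ?C, ts')"
    unfolding One_nat_def using ss(3) by (metis steps_Suc steps_refl)
  from steps_trans [OF ss(2) this] have "steps ?C (Suc (j + 1)) (start_state ?C, ts) (halt_state ?C, ts')"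
    using steps_Suc ss(1) by metis
  then show ?thesis by (simp add: runs_def)
qed

lemma runs_while_tm_False:
  assumes "\<not> b (map tape_read ts)"
  shows "runs (while_tm b M) 1 ts ts"
proof -
  have "tm_step (while_tm b M) (start_state (while_tm b M), ts) = (halt_state (while_tm b M), ts)"
    using assms by (simp add: while_tm_def)
  then show ?thesis unfolding runs_def One_nat_def by (metis steps_Suc steps_refl)
qed

lemma runs_while_tm_True:
  assumes fits: "fits k n M" and ts: "valid_tapes k n ts"
    and b: "b (map tape_read ts)" and M: "runs M i ts ts'" and W: "runs (while_tm b M) j ts' ts''"
  shows "runs (while_tm b M) (i + j + 2) ts ts''"
proof -
  let ?W = "while_tm b M"
  note h = fitsD(4,5) [OF fits]
  have "embeds 0 M ?W"
    using h by (auto simp: embeds_def while_tm_def split: prod.splits)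
  then have 1: "steps ?W i (start_state M, ts) (halt_state M, ts')"
    using embeds_runs [OF _ fits ts M] by fastforce
  have 2: "tm_step ?W (start_state ?W, ts) = (start_state M, ts)"
    "tm_step ?W (halt_state M, ts') = (start_state ?W, ts')"
    using h b by (simp_all add: while_tm_def)
  have "steps ?W (Suc j) (halt_state M, ts') (halt_state ?W, ts'')"
    using W 2(2) steps_Suc unfolding runs_def by metis
  from steps_trans [OF 1 this] have "steps ?W (Suc (i + Suc j)) (start_state ?W, ts) (halt_state ?W, ts'')"
    using 2(1) steps_Suc by metis
  then show ?thesis by (simp add: runs_def)
qed

text \<open>On the symbols of the larger alphabet the transition function of \<open>M\<close> is
  unconstrained. Standing still there keeps the machine well-formed and does not affect runs over
  the old alphabet.\<close>

definition lift_tm :: "nat \<Rightarrow> nat \<Rightarrow> tm \<Rightarrow> tm" where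
  "lift_tm k n M = \<lparr> num_tapes = k, num_symbols = n, num_states = num_states M,
     start_state = start_state M, halt_state = halt_state M,
     delta = (\<lambda>s xs.
       if set (take (num_tapes M) xs) \<subseteq> {..<num_symbols M}
         then let (s', acts) = delta M s (take (num_tapes M) xs)
              in (s', acts @ stay (drop (num_tapes M) xs))
       else (s, stay xs)) \<rparr>"

lemma fits_lift_tm:
  assumes M: "fits l m M" and "l \<le> k" "m \<le> n"
  shows "fits k n (lift_tm k n M)"
proof (rule fitsI)
  fix s xs s' acts
  assume s: "s < num_states (lift_tm k n M)" "length xs = k" "set xs \<subseteq> {..<n}"
    "delta (lift_tm k n M) s xs = (s', acts)"
  show "s' < num_states (lift_tm k n M) \<and> length acts = k \<and> (\<forall>a\<in>set acts. fst a < n)"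
  proof (cases "set (take l xs) \<subseteq> {..<m}")
    case True
    then obtain acts1 where a: "delta M s (take l xs) = (s', acts1)" "acts = acts1 @ stay (drop l xs)"
      using s fitsD [OF M] by (auto simp: lift_tm_def split: prod.splits)
    have "length (take l xs) = l" using s(2) \<open>l \<le> k\<close> by simp
    with True a s fits_delta [OF M, of s "take l xs" s' acts1]
    have "s' < num_states M" "length acts1 = l" "\<forall>a\<in>set acts1. fst a < m"
      by (auto simp: lift_tm_def)
    moreover have "\<forall>x\<in>set xs. x < n" using s(3) by auto
    ultimately show ?thesis using a(2) s(2) assms(2,3)
      by (auto simp: lift_tm_def dest!: in_set_dropD)
  qed (use s fitsD [OF M] in \<open>auto simp: lift_tm_def\<close>)
qed (use fitsD [OF M] assms in \<open>simp_all add: lift_tm_def\<close>)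

lemma tm_step_lift:
  assumes M: "fits l m M" and "valid_tapes l m ts" "s < num_states M" "tm_step M (s, ts) = (s', ts')"
  shows "tm_step (lift_tm k n M) (s, ts @ us) = (s', ts' @ us)"
proof (cases "s = halt_state M")
  case False
  have l: "length ts = l" "set (map tape_read ts) \<subseteq> {..<m}"
    using assms(2) tape_read_less by (auto simp: valid_tapes_def)
  obtain acts where d: "delta M s (map tape_read ts) = (s', acts)" "ts' = map2 tape_act acts ts"
    using False assms(4) by (auto split: prod.splits)
  have "length acts = l" using fits_delta [OF M assms(3) _ l(2) d(1)] l by simp
  then show ?thesis using False d l fitsD [OF M] by (simp add: lift_tm_def)
qed (use assms in \<open>auto simp: lift_tm_def\<close>)

lemma runs_lift_tm:
  assumes M: "fits l m M" and ts: "valid_tapes l m ts" and run: "runs M j ts ts'"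
  shows "runs (lift_tm k n M) j (ts @ us) (ts' @ us)"
proof -
  have "(tm_step M ^^ j) (start_state M, ts) = (s', ts') \<Longrightarrow>
    (tm_step (lift_tm k n M) ^^ j) (start_state M, ts @ us) = (s', ts' @ us)" for s' ts'
  proof (induction j arbitrary: s' ts')
    case (Suc j)
    obtain s1 ts1 where 1: "(tm_step M ^^ j) (start_state M, ts) = (s1, ts1)" by force
    then have "s1 < num_states M" "valid_tapes l m ts1"
      using funpow_tm_step_valid [OF M fitsD(4) [OF M] ts] by blast+
    then show ?case using Suc.IH [OF 1] Suc.prems 1 tm_step_lift [OF M] by simp
  qed simp
  then show ?thesis using run by (simp add: runs_iff lift_tm_def)
qed

section \<open>Programs over stacks\<close>

text \<open>Tests and pushed symbols may depend on the tops of all stacks, since a machine with one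
  tape per stack reads them all in a single step.\<close>

datatype 'r com =
    Push 'r "('r \<Rightarrow> nat) \<Rightarrow> nat"
  | Pop 'r
  | Seq "'r com" "'r com" (infixr ";;" 60)
  | Cond "('r \<Rightarrow> nat) \<Rightarrow> bool" "'r com" "'r com"
  | Loop "('r \<Rightarrow> nat) \<Rightarrow> bool" "'r com"

type_synonym 'r state = "'r \<Rightarrow> nat list"

definition peek :: "nat list \<Rightarrow> nat" where
  "peek w = (case w of [] \<Rightarrow> 0 | a # _ \<Rightarrow> a)"

lemma peek_simps [simp]: "peek [] = 0" "peek (a # w) = a"
  by (simp_all add: peek_def)

text \<open>The blank marks the end of a stack and cannot be an entry. Letting its push do nothing
  provides conditional pushes, copying from a possibly empty stack, and a command without
  effect.\<close>

definition push :: "nat \<Rightarrow> nat list \<Rightarrow> nat list" where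
  "push a w = (if a = 0 then w else a # w)"

text \<open>The numbers are those of the compiled machines: a push is a composition of two single
  steps, and the other summands are the overheads of sequencing, branching and looping.
  \<open>exec_mono\<close> lets bounds be rounded up anywhere.\<close>

inductive exec :: "'r com \<Rightarrow> 'r state \<Rightarrow> nat \<Rightarrow> 'r state \<Rightarrow> bool" where
  exec_Push: "exec (Push r f) s 3 (s(r := push (f (\<lambda>r. peek (s r))) (s r)))"
| exec_Pop: "exec (Pop r) s 1 (s(r := tl (s r)))"
| exec_Seq: "exec c s t s' \<Longrightarrow> exec d s' t' s'' \<Longrightarrow> exec (c ;; d) s (t + t' + 1) s''"
| exec_Cond: "exec (if b (\<lambda>r. peek (s r)) then c else d) s t s' \<Longrightarrow> exec (Cond b c d) s (t + 2) s'"
| exec_Loop_False: "\<not> b (\<lambda>r. peek (s r)) \<Longrightarrow> exec (Loop b c) s 1 s"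
| exec_Loop_True: "b (\<lambda>r. peek (s r)) \<Longrightarrow> exec c s t s' \<Longrightarrow> exec (Loop b c) s' t' s'' \<Longrightarrow>
    exec (Loop b c) s (t + t' + 2) s''"
| exec_mono: "exec c s t s' \<Longrightarrow> t \<le> t' \<Longrightarrow> exec c s t' s'"

text \<open>A push takes two steps of the machine, and in the second one the head of tape \<open>r\<close> no longer
  reads the peek of the stack, so the pushed symbol must not depend on it.\<close>

primrec wf_com :: "nat \<Rightarrow> 'r com \<Rightarrow> bool" where
  "wf_com n (Push r f) \<longleftrightarrow>
     (\<forall>\<tau>. (\<forall>q. \<tau> q < n) \<longrightarrow> f \<tau> < n) \<and> (\<forall>\<tau> x. f (\<tau>(r := x)) = f \<tau>)"
| "wf_com n (Pop r) \<longleftrightarrow> True"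
| "wf_com n (c ;; d) \<longleftrightarrow> wf_com n c \<and> wf_com n d"
| "wf_com n (Cond b c d) \<longleftrightarrow> wf_com n c \<and> wf_com n d"
| "wf_com n (Loop b c) \<longleftrightarrow> wf_com n c"

section \<open>Compilation of stack programs to machines\<close>

definition act_tm :: "nat \<Rightarrow> nat \<Rightarrow> nat \<Rightarrow> (nat list \<Rightarrow> nat \<times> move) \<Rightarrow> tm" where
  "act_tm k n j f = \<lparr> num_tapes = k, num_symbols = n, num_states = 2, start_state = 0,
     halt_state = 1, delta = (\<lambda>s xs. (1, (stay xs)[j := f xs])) \<rparr>"

lemma fits_act_tm:
  assumes "0 < n" "j < k" "\<And>xs. length xs = k \<Longrightarrow> set xs \<subseteq> {..<n} \<Longrightarrow> fst (f xs) < n"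
  shows "fits k n (act_tm k n j f)"
proof (rule fitsI)
  fix s xs s' acts
  assume s: "length xs = k" "set xs \<subseteq> {..<n}" "delta (act_tm k n j f) s xs = (s', acts)"
  then have f: "fst (f xs) < n" using assms(3) by blast
  have "fst a < n" if "a \<in> set ((stay xs)[j := f xs])" for a
  proof -
    have "fst a = fst (f xs) \<or> fst a \<in> set xs"
      using stay_update_symbols [of a xs j "fst (f xs)" "snd (f xs)"] that by simp
    then show ?thesis using f s(2) by auto
  qed
  then show "s' < num_states (act_tm k n j f) \<and> length acts = k \<and> (\<forall>a\<in>set acts. fst a < n)"
    using s by (auto simp: act_tm_def)
qed (use assms in \<open>simp_all add: act_tm_def\<close>)

lemma runs_act_tm:
  assumes "j < length ts"
  shows "runs (act_tm k n j f) 1 ts (ts[j := tape_act (f (map tape_read ts)) (ts ! j)])"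
  using map2_stay_update [OF assms, of "fst (f (map tape_read ts))" "snd (f (map tape_read ts))"]
  by (simp add: runs_iff act_tm_def)

text \<open>A step writes before it moves, so a push goes to the fresh cell first and fills it
  afterwards. A pop blanks the cell that it leaves, so that a tape which is blank left of the head
  remains so; on an empty stack the head stays at the end mark.\<close>

primrec compile :: "nat \<Rightarrow> nat \<Rightarrow> ('r \<Rightarrow> nat) \<Rightarrow> 'r com \<Rightarrow> tm" where
  "compile k n \<rho> (Push r f) =
     seq_tm
       (act_tm k n (\<rho> r)
         (\<lambda>xs. (xs ! \<rho> r, if f (\<lambda>r. xs ! \<rho> r) = 0 then Stay else Left)))
       (act_tm k n (\<rho> r)
         (\<lambda>xs. (if f (\<lambda>r. xs ! \<rho> r) = 0 then xs ! \<rho> r else f (\<lambda>r. xs ! \<rho> r), Stay)))"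
| "compile k n \<rho> (Pop r) = act_tm k n (\<rho> r) (\<lambda>xs. if xs ! \<rho> r = 0 then (0, Stay) else (0, Right))"
| "compile k n \<rho> (c ;; d) = seq_tm (compile k n \<rho> c) (compile k n \<rho> d)"
| "compile k n \<rho> (Cond b c d) =
     cond_tm (\<lambda>xs. b (\<lambda>r. xs ! \<rho> r)) (compile k n \<rho> c) (compile k n \<rho> d)"
| "compile k n \<rho> (Loop b c) = while_tm (\<lambda>xs. b (\<lambda>r. xs ! \<rho> r)) (compile k n \<rho> c)"

lemma fits_compile:
  assumes "0 < n" and \<rho>: "\<And>r. \<rho> r < k"
  shows "wf_com n c \<Longrightarrow> fits k n (compile k n \<rho> c)"
proof (induction c)
  case (Push r f)
  have "xs ! \<rho> q < n" if "length xs = k" "set xs \<subseteq> {..<n}" for xs q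
    using that \<rho> nth_mem by blast
  then show ?case using Push assms by (auto intro!: fits_seq_tm fits_act_tm)
qed (use assms in \<open>auto intro!: fits_act_tm fits_seq_tm fits_cond_tm fits_while_tm\<close>)

text \<open>The stack \<open>w\<close> lies to the right of the head.  Beyond the blank that ends it the tape is
  arbitrary; if \<open>E\<close> is \<open>Some L\<close> then all other cells are blank and the bottom of the stack is
  next to cell \<open>L\<close>, which determines the tape.\<close>

definition holds_stack :: "int option \<Rightarrow> tape \<Rightarrow> nat list \<Rightarrow> bool" where
  "holds_stack E T w \<longleftrightarrow> tape_output T w \<and>
     (\<forall>L. E = Some L \<longrightarrow> snd T + int (length w) = L \<and> (\<forall>z. z < snd T \<or> z \<ge> L \<longrightarrow> fst T z = 0))"

lemma tape_output_Cons:
  "tape_output (t, h) (a # w) \<longleftrightarrow> t h = a \<and> a \<noteq> 0 \<and> tape_output (t, h + 1) w"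
  by (auto simp: All_less_Suc2 algebra_simps)

lemma tape_output_cong:
  "(\<And>z. z \<ge> h \<Longrightarrow> t z = t' z) \<Longrightarrow> tape_output (t, h) w \<longleftrightarrow> tape_output (t', h) w"
  by auto

lemma holds_stack_peek: "holds_stack E T w \<Longrightarrow> tape_read T = peek w"
  by (cases T; cases w) (auto simp: holds_stack_def tape_output_Cons simp del: tape_output.simps,
      simp)

lemma holds_stack_push:
  assumes "holds_stack E T w" "0 < a"
  shows "holds_stack E (tape_act (a, Stay) (tape_act (tape_read T, Left) T)) (a # w)"
proof -
  obtain t h where T: "T = (t, h)" by force
  have "tape_output (t(h - 1 := a), h) w"
    using assms by (auto simp: holds_stack_def T)
  then have "tape_output (t(h - 1 := a), h - 1) (a # w)"
    unfolding tape_output_Cons using assms(2) by simp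
  then show ?thesis using assms by (auto simp: holds_stack_def T simp del: tape_output.simps)
qed

lemma holds_stack_pop:
  assumes "holds_stack E T w"
  shows "holds_stack E (tape_act (if tape_read T = 0 then (0, Stay) else (0, Right)) T) (tl w)"
proof (cases w)
  case Nil
  obtain t h where T: "T = (t, h)" by force
  have "t(h := 0) = t" using assms Nil by (auto simp: holds_stack_def T)
  then show ?thesis using assms Nil by (auto simp: holds_stack_def T)
next
  case (Cons a v)
  obtain t h where T: "T = (t, h)" by force
  have "t h = a" "a \<noteq> 0" "tape_output (t, h + 1) v"
    using assms by (auto simp: holds_stack_def T Cons tape_output_Cons simp del: tape_output.simps)
  moreover from this have "tape_output (t(h := 0), h + 1) v"
    by (subst tape_output_cong [of _ _ t]) auto
  ultimately show ?thesis using assms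
    by (auto simp: holds_stack_def T Cons simp del: tape_output.simps)
qed

text \<open>\<open>E\<close> is the same before and after. Its exact form is what later restores the
  input tape of the simulated machine, its loose form suffices on tapes with garbage. The last
  conjunct keeps the other tapes of that machine blank.\<close>

lemma compile_correct:
  assumes "exec c s t s'" and n: "0 < n" and \<rho>: "\<And>r. \<rho> r < k" "inj \<rho>"
  shows "wf_com n c \<Longrightarrow> valid_tapes k n ts \<Longrightarrow> (\<And>r. holds_stack (E r) (ts ! \<rho> r) (s r)) \<Longrightarrow>
    \<exists>ts'. runs (compile k n \<rho> c) t ts ts' \<and> (\<forall>r. holds_stack (E r) (ts' ! \<rho> r) (s' r)) \<and>
      (\<forall>j. j \<notin> range \<rho> \<longrightarrow> ts' ! j = ts ! j)"
  using assms(1)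
proof (induction arbitrary: ts)
  case (exec_Push r f s)
  have lens: "\<rho> q < length ts" for q using exec_Push \<rho> by (auto simp: valid_tapes_def)
  note len = lens [of r]
  have tops: "(\<lambda>r. map tape_read ts ! \<rho> r) = (\<lambda>r. peek (s r))"
    using holds_stack_peek [OF exec_Push(3)] lens by auto
  define a where "a = f (\<lambda>r. peek (s r))"
  define ts1 where "ts1 = ts[\<rho> r := tape_act (tape_read (ts ! \<rho> r), if a = 0 then Stay else Left) (ts ! \<rho> r)]"
  define ts2 where "ts2 = ts1[\<rho> r :=
     tape_act (if a = 0 then tape_read (ts1 ! \<rho> r) else a, Stay) (ts1 ! \<rho> r)]"
  \<comment> \<open>In the second step only the symbol on the tape of \<open>r\<close> can differ,
    and well-formedness makes \<open>f\<close> insensitive to it, so both steps use the same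
    \<open>a\<close>.\<close>
  have "(\<lambda>q. map tape_read ts1 ! \<rho> q) = (\<lambda>q. map tape_read ts ! \<rho> q)(r := map tape_read ts1 ! \<rho> r)"
    using inj_eq [OF \<rho>(2)] lens by (auto simp: ts1_def nth_list_update fun_eq_iff)
  then have a1: "f (\<lambda>q. map tape_read ts1 ! \<rho> q) = a"
    using exec_Push.prems(1) by (simp add: tops a_def)
  have xs: "xs ! \<rho> q < n" if "length xs = k" "set xs \<subseteq> {..<n}" for xs q
    using that \<rho> nth_mem by blast
  have "runs (compile k n \<rho> (Push r f)) (1 + 1 + 1) ts ts2"
    unfolding compile.simps
  proof (rule runs_seq_tm [OF fits_act_tm fits_act_tm exec_Push(2)])
    have "map tape_read ts ! \<rho> r = tape_read (ts ! \<rho> r)" using len by simp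
    then show "runs (act_tm k n (\<rho> r) (\<lambda>xs. (xs ! \<rho> r, if f (\<lambda>r. xs ! \<rho> r) = 0 then Stay else Left)))
        1 ts ts1"
      using runs_act_tm [OF len, of k n "\<lambda>xs. (xs ! \<rho> r, if f (\<lambda>r. xs ! \<rho> r) = 0 then Stay else Left)"]
      unfolding tops a_def [symmetric] ts1_def by simp
    have len1: "\<rho> r < length ts1" using len by (simp add: ts1_def)
    then have "map tape_read ts1 ! \<rho> r = tape_read (ts1 ! \<rho> r)" by simp
    then show "runs (act_tm k n (\<rho> r)
         (\<lambda>xs. (if f (\<lambda>r. xs ! \<rho> r) = 0 then xs ! \<rho> r else f (\<lambda>r. xs ! \<rho> r), Stay))) 1 ts1 ts2"
      using runs_act_tm [OF len1, of k n
          "\<lambda>xs. (if f (\<lambda>r. xs ! \<rho> r) = 0 then xs ! \<rho> r else f (\<lambda>r. xs ! \<rho> r), Stay)"]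
      unfolding a1 ts2_def by (simp only:)
  qed (use n \<rho> xs exec_Push.prems(1) in auto)
  then have "runs (compile k n \<rho> (Push r f)) 3 ts ts2" by (simp add: numeral_3_eq_3)
  moreover have "holds_stack (E r') (ts2 ! \<rho> r') ((s(r := push a (s r))) r')" for r'
  proof (cases "r' = r \<and> a \<noteq> 0")
    case True
    then have "ts2 ! \<rho> r = tape_act (a, Stay) (tape_act (tape_read (ts ! \<rho> r), Left) (ts ! \<rho> r))"
      using len by (simp add: ts1_def ts2_def)
    then show ?thesis using True holds_stack_push [OF exec_Push(3) [of r], of a] by (simp add: push_def)
  next
    case False
    then have "ts2 ! \<rho> r' = ts ! \<rho> r'"
      using inj_eq [OF \<rho>(2)] len by (auto simp: ts1_def ts2_def nth_list_update)
    then show ?thesis using False exec_Push(3) by (auto simp: push_def)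
  qed
  moreover have "\<forall>j. j \<notin> range \<rho> \<longrightarrow> ts2 ! j = ts ! j"
    unfolding ts1_def ts2_def by (metis nth_list_update_neq rangeI)
  ultimately show ?case unfolding a_def by blast
next
  case (exec_Pop r s)
  have len: "\<rho> r < length ts" using exec_Pop \<rho> by (auto simp: valid_tapes_def)
  define ts1 where "ts1 = ts[\<rho> r :=
     tape_act (if tape_read (ts ! \<rho> r) = 0 then (0, Stay) else (0, Right)) (ts ! \<rho> r)]"
  have "runs (compile k n \<rho> (Pop r)) 1 ts ts1"
    using runs_act_tm [OF len, of k n "\<lambda>xs. if xs ! \<rho> r = 0 then (0, Stay) else (0, Right)"] len
    by (simp add: ts1_def)
  moreover have "holds_stack (E r') (ts1 ! \<rho> r') ((s(r := tl (s r))) r')" for r'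
    using holds_stack_pop [OF exec_Pop(3) [of r]] exec_Pop(3) inj_eq [OF \<rho>(2)] len
    by (cases "r' = r") (auto simp: ts1_def)
  moreover have "\<forall>j. j \<notin> range \<rho> \<longrightarrow> ts1 ! j = ts ! j"
    unfolding ts1_def by (metis nth_list_update_neq rangeI)
  ultimately show ?case by (intro exI [of _ ts1]) auto
next
  case (exec_Seq c s t s' d t' s'')
  have fits: "fits k n (compile k n \<rho> c)" "fits k n (compile k n \<rho> d)"
    using exec_Seq.prems fits_compile [OF n, of \<rho>] \<rho> by auto
  obtain ts1 where 1: "runs (compile k n \<rho> c) t ts ts1" "\<forall>r. holds_stack (E r) (ts1 ! \<rho> r) (s' r)"
    "\<forall>j. j \<notin> range \<rho> \<longrightarrow> ts1 ! j = ts ! j"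
    using exec_Seq.IH(1) [of ts] exec_Seq.prems by auto
  moreover obtain ts2 where 2: "runs (compile k n \<rho> d) t' ts1 ts2"
    "\<forall>r. holds_stack (E r) (ts2 ! \<rho> r) (s'' r)" "\<forall>j. j \<notin> range \<rho> \<longrightarrow> ts2 ! j = ts1 ! j"
    using exec_Seq.IH(2) [of ts1] exec_Seq.prems 1 runs_valid [OF fits(1) _ 1(1)] by auto
  ultimately show ?case
    using runs_seq_tm [OF fits exec_Seq.prems(2) 1(1) 2(1)] by (intro exI [of _ ts2]) auto
next
  case (exec_Cond b s c d t s')
  have fits: "fits k n (compile k n \<rho> c)" "fits k n (compile k n \<rho> d)"
    using exec_Cond.prems fits_compile [OF n, of \<rho>] \<rho> by auto
  have tops: "(\<lambda>r. map tape_read ts ! \<rho> r) = (\<lambda>r. peek (s r))"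
    using exec_Cond.prems(2) holds_stack_peek [OF exec_Cond.prems(3)] \<rho>
    by (auto simp: valid_tapes_def)
  have "wf_com n (if b (\<lambda>r. peek (s r)) then c else d)"
    using exec_Cond.prems(1) by simp
  from exec_Cond.IH [OF this exec_Cond.prems(2,3)]
  obtain ts1 where 1: "runs (compile k n \<rho> (if b (\<lambda>r. peek (s r)) then c else d)) t ts ts1"
    "\<forall>r. holds_stack (E r) (ts1 ! \<rho> r) (s' r)" "\<forall>j. j \<notin> range \<rho> \<longrightarrow> ts1 ! j = ts ! j"
    by blast
  have "runs (compile k n \<rho> (Cond b c d)) (t + 2) ts ts1"
    unfolding compile.simps
    by (rule runs_cond_tm [OF fits exec_Cond.prems(2)]) (use 1(1) in \<open>simp add: tops if_distrib\<close>)
  with 1 show ?case by blast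
next
  case (exec_Loop_False b s c)
  have tops: "(\<lambda>r. map tape_read ts ! \<rho> r) = (\<lambda>r. peek (s r))"
    using exec_Loop_False.prems(2) holds_stack_peek [OF exec_Loop_False.prems(3)] \<rho>
    by (auto simp: valid_tapes_def)
  have "runs (compile k n \<rho> (Loop b c)) 1 ts ts"
    unfolding compile.simps by (rule runs_while_tm_False) (use exec_Loop_False in \<open>simp add: tops\<close>)
  then show ?case using exec_Loop_False.prems by blast
next
  case (exec_Loop_True b s c t s' t' s'')
  have fits: "fits k n (compile k n \<rho> c)"
    using exec_Loop_True.prems fits_compile [OF n, of \<rho>] \<rho> by auto
  have tops: "(\<lambda>r. map tape_read ts ! \<rho> r) = (\<lambda>r. peek (s r))"
    using exec_Loop_True.prems(2) holds_stack_peek [OF exec_Loop_True.prems(3)] \<rho>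
    by (auto simp: valid_tapes_def)
  obtain ts1 where 1: "runs (compile k n \<rho> c) t ts ts1" "\<forall>r. holds_stack (E r) (ts1 ! \<rho> r) (s' r)"
    "\<forall>j. j \<notin> range \<rho> \<longrightarrow> ts1 ! j = ts ! j"
    using exec_Loop_True.IH(1) [of ts] exec_Loop_True.prems by auto
  moreover obtain ts2 where 2: "runs (compile k n \<rho> (Loop b c)) t' ts1 ts2"
    "\<forall>r. holds_stack (E r) (ts2 ! \<rho> r) (s'' r)" "\<forall>j. j \<notin> range \<rho> \<longrightarrow> ts2 ! j = ts1 ! j"
    using exec_Loop_True.IH(2) [of ts1] exec_Loop_True.prems 1 runs_valid [OF fits _ 1(1)] by auto
  moreover have "runs (compile k n \<rho> (Loop b c)) (t + t' + 2) ts ts2"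
    unfolding compile.simps
    by (rule runs_while_tm_True [OF fits exec_Loop_True.prems(2) _ 1(1)])
      (use exec_Loop_True.hyps 2(1) in \<open>simp_all add: tops\<close>)
  ultimately show ?case by (intro exI [of _ ts2]) auto
next
  case (exec_mono c s t s' t')
  then show ?case using runs_mono by meson
qed

section \<open>Loop-free commands and rules for time bounds\<close>

primrec straight :: "'r com \<Rightarrow> bool" where
  "straight (Push r f) \<longleftrightarrow> True"
| "straight (Pop r) \<longleftrightarrow> True"
| "straight (c ;; d) \<longleftrightarrow> straight c \<and> straight d"
| "straight (Cond b c d) \<longleftrightarrow> straight c \<and> straight d"
| "straight (Loop b c) \<longleftrightarrow> False"

primrec cost :: "'r com \<Rightarrow> nat" where
  "cost (Push r f) = 3"
| "cost (Pop r) = 1"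
| "cost (c ;; d) = cost c + cost d + 1"
| "cost (Cond b c d) = max (cost c) (cost d) + 2"
| "cost (Loop b c) = 0"

primrec result :: "'r com \<Rightarrow> 'r state \<Rightarrow> 'r state" where
  "result (Push r f) s = s(r := push (f (\<lambda>r. peek (s r))) (s r))"
| "result (Pop r) s = s(r := tl (s r))"
| "result (c ;; d) s = result d (result c s)"
| "result (Cond b c d) s = (if b (\<lambda>r. peek (s r)) then result c s else result d s)"
| "result (Loop b c) s = s"

text \<open>Without loops, effect and worst-case time are given by recursion, so the simplifier can
  execute a loop body symbolically.\<close>

lemma exec_straight: "straight c \<Longrightarrow> exec c s (cost c) (result c s)"
proof (induction c arbitrary: s)
  case (Cond b c d)
  then have "exec (if b (\<lambda>r. peek (s r)) then c else d) s (max (cost c) (cost d)) (result (Cond b c d) s)"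
    using exec_mono [OF Cond.IH(1)] exec_mono [OF Cond.IH(2)] by auto
  then show ?case using exec_Cond by fastforce
qed (auto intro: exec_Push exec_Pop [simplified] exec_Seq [simplified])

lemma exec_straightI:
  "straight c \<Longrightarrow> cost c \<le> t \<Longrightarrow> result c s = s' \<Longrightarrow> exec c s t s'"
  using exec_straight exec_mono by blast

lemma exec_SeqI: "exec c s t s' \<Longrightarrow> exec d s' t' s'' \<Longrightarrow> t + t' + 1 \<le> u \<Longrightarrow> exec (c ;; d) s u s''"
  using exec_Seq exec_mono by blast

lemma exec_CondI:
  "exec (if b (\<lambda>r. peek (s r)) then c else d) s t s' \<Longrightarrow> t + 2 \<le> u \<Longrightarrow> exec (Cond b c d) s u s'"
  using exec_Cond exec_mono by blast

lemma exec_LoopI: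
  "b (\<lambda>r. peek (s r)) \<Longrightarrow> exec c s t s' \<Longrightarrow> exec (Loop b c) s' t' s'' \<Longrightarrow> t + t' + 2 \<le> u \<Longrightarrow>
    exec (Loop b c) s u s''"
  using exec_Loop_True exec_mono by blast

lemma exec_Loop_end: "\<not> b (\<lambda>r. peek (s r)) \<Longrightarrow> s' = s \<Longrightarrow> 1 \<le> t \<Longrightarrow> exec (Loop b c) s t s'"
  using exec_Loop_False exec_mono by blast

lemma exec_eq: "exec c s t s' \<Longrightarrow> s' = s'' \<Longrightarrow> t \<le> t' \<Longrightarrow> exec c s t' s''"
  using exec_mono by blast

text \<open>\<open>In\<close> holds the input and later the answer of the assumed algorithm,
  \<open>Src\<close> the copied instance; \<open>Mkt\<close>, \<open>Own\<close>, \<open>New\<close>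
  hold utilities, given and computed assignment in reverse. \<open>SumP\<close> and
  \<open>SumQ\<close> are numerators over \<open>Den\<close>, the primed registers their successors
  under construction, and \<open>Num\<close> is a numerator times \<open>Den\<close>.
  \<open>Diff\<close> is nonempty once a difference has been found; \<open>Tmp1\<close>,
  \<open>Tmp2\<close>, \<open>Carry\<close> are scratch.\<close>

datatype reg = In | Src | Mkt | Own | New | SumP | SumQ | Den | SumP' | SumQ' | Den' | Num
  | Tmp1 | Tmp2 | Carry | Diff | Out

section \<open>Moving and clearing stacks\<close>

definition move_while :: "(nat \<Rightarrow> bool) \<Rightarrow> reg \<Rightarrow> reg \<Rightarrow> reg com" where
  "move_while p X Z = Loop (\<lambda>\<tau>. p (\<tau> X)) (Push Z (\<lambda>\<tau>. \<tau> X) ;; Pop X)"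

abbreviation move_all :: "reg \<Rightarrow> reg \<Rightarrow> reg com" where
  "move_all \<equiv> move_while (\<lambda>a. a \<noteq> 0)"

definition clear :: "reg \<Rightarrow> reg com" where
  "clear X = Loop (\<lambda>\<tau>. \<tau> X \<noteq> 0) (Pop X)"

text \<open>Seven steps per symbol: five for a push and a pop in sequence, two for the loop. The
  reversal is what lets encodings be read backwards.\<close>

lemma exec_move_while:
  assumes "X \<noteq> Z"
  shows "\<forall>a\<in>set u. p a \<and> a \<noteq> 0 \<Longrightarrow> \<not> p (peek v) \<Longrightarrow> s X = u @ v \<Longrightarrow>
    exec (move_while p X Z) s (7 * length u + 1) (s(X := v, Z := rev u @ s Z))"
proof (induction u arbitrary: s)
  case Nil
  then show ?case using assms unfolding move_while_def by (intro exec_Loop_end) auto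
next
  case (Cons a u)
  define s1 where "s1 = s(X := u @ v, Z := a # s Z)"
  have "exec (Push Z (\<lambda>\<tau>. \<tau> X) ;; Pop X) s 5 s1"
    using Cons.prems assms by (intro exec_straightI) (auto simp: s1_def push_def fun_eq_iff)
  moreover have "exec (move_while p X Z) s1 (7 * length u + 1) (s1(X := v, Z := rev u @ s1 Z))"
    using Cons assms by (intro Cons.IH) (auto simp: s1_def)
  ultimately have "exec (move_while p X Z) s (7 * length (a # u) + 1) (s1(X := v, Z := rev u @ s1 Z))"
    using Cons.prems unfolding move_while_def by (auto intro: exec_LoopI)
  then show ?case
    by (rule exec_eq) (use assms in \<open>auto simp: s1_def fun_eq_iff\<close>)
qed

lemma exec_move_all:
  assumes "X \<noteq> Z" "0 \<notin> set (s X)"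
  shows "exec (move_all X Z) s (7 * length (s X) + 1) (s(X := [], Z := rev (s X) @ s Z))"
  by (rule exec_move_while) (use assms in \<open>auto intro: ccontr\<close>)

lemma exec_clear:
  assumes "0 \<notin> set (s X)"
  shows "exec (clear X) s (3 * length (s X) + 1) (s(X := []))"
  using assms
proof (induction "s X" arbitrary: s)
  case Nil
  then show ?case unfolding clear_def by (intro exec_Loop_end) auto
next
  case (Cons a u)
  have "exec (Pop X) s 1 (s(X := u))"
    using Cons.hyps(2) exec_Pop [of X s] by (metis list.sel(3))
  moreover have "exec (clear X) (s(X := u)) (3 * length u + 1) (s(X := []))"
    using Cons.hyps(1) [of "s(X := u)"] Cons.prems Cons.hyps(2) by (auto simp del: One_nat_def) (metis list.set_intros(2))
  moreover have "peek (s X) \<noteq> 0" using Cons by (metis list.set_intros(1) peek_simps(2))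
  ultimately show ?case using Cons.hyps(2) [symmetric] unfolding clear_def by (auto intro: exec_LoopI)
qed

section \<open>Binary arithmetic\<close>

definition digits :: "nat list \<Rightarrow> bool" where
  "digits w \<longleftrightarrow> set w \<subseteq> {1, 2}"

text \<open>Every symbol other than \<open>2\<close> counts as the digit zero, and so does the blank
  read off an exhausted stack. Numbers are never normalised; zeros at the most significant end do no
  harm.\<close>

primrec val :: "nat list \<Rightarrow> nat" where
  "val [] = 0"
| "val (a # w) = of_bool (a = 2) + 2 * val w"

lemma val_unfold: "val w = of_bool (peek w = 2) + 2 * val (tl w)"
  by (cases w) auto

definition bit_sym :: "bool \<Rightarrow> nat" where
  "bit_sym b = (if b then sym_one else sym_zero)"

lemma bit_simps [simp]: "0 < bit_sym b" "bit_sym b = 2 \<longleftrightarrow> b" "bit_sym b = Suc 0 \<longleftrightarrow> \<not> b" "push (bit_sym b) w = bit_sym b # w"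
  by (auto simp: bit_sym_def push_def)

text \<open>A threefold equivalence holds if and only if an odd number of its members hold: it is
  the exclusive or of a full adder.\<close>

definition sum_bit :: "nat \<Rightarrow> nat \<Rightarrow> bool \<Rightarrow> nat" where
  "sum_bit a b c = bit_sym ((a = 2) = ((b = 2) = c))"

text \<open>The majority of the three bits.\<close>

definition carry_out :: "nat \<Rightarrow> nat \<Rightarrow> bool \<Rightarrow> bool" where
  "carry_out a b c = (if (a = 2) = (b = 2) then a = 2 else c)"

text \<open>The old carry is off the stack when the new one is pushed; it is recovered from the sum.\<close>

definition carry_bit :: "nat \<Rightarrow> nat \<Rightarrow> nat \<Rightarrow> nat" where
  "carry_bit a b z = bit_sym (if (a = 2) = (b = 2) then a = 2 else z \<noteq> 2)"

text \<open>If the two digits agree, they alone decide the new carry. If they differ, the sum digit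
  is the negation of the old carry, which is also the new one.\<close>

lemma carry_bit_sum_bit [simp]: "carry_bit a b (sum_bit a b c) = bit_sym (carry_out a b c)"
  by (auto simp: carry_bit_def sum_bit_def carry_out_def)

lemma push_sum_bit [simp]: "push (sum_bit a b c) w = sum_bit a b c # w"
  by (simp add: sum_bit_def)

function addc :: "bool \<Rightarrow> nat list \<Rightarrow> nat list \<Rightarrow> nat list" where
  "addc c v w = (if v = [] \<and> w = [] \<and> \<not> c then []
     else sum_bit (peek v) (peek w) c # addc (carry_out (peek v) (peek w) c) (tl v) (tl w))"
  by pat_completeness auto
termination
\<comment> \<open>A carry can arise anew only when both words lose a digit; if one of them is
  exhausted the carry does not increase, and a carry left alone is used up.\<close>
proof (relation "measure (\<lambda>(c, v, w). length v + length w + of_bool c)", goal_cases)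
  case (2 c v w)
  then show ?case by (cases v; cases w) (auto simp: carry_out_def)
qed simp

declare addc.simps [simp del]

lemma val_addc: "val (addc c v w) = val v + val w + of_bool c"
proof (induction c v w rule: addc.induct)
  case (1 c v w)
  show ?case
  proof (cases "v = [] \<and> w = [] \<and> \<not> c")
    case False
    then show ?thesis using 1 val_unfold [of v] val_unfold [of w]
      by (subst addc.simps) (auto simp: sum_bit_def carry_out_def)
  qed (simp add: addc.simps)
qed

lemma length_addc: "length (addc c v w) \<le> max (length v) (length w) + 1"
proof (induction c v w rule: addc.induct)
  case (1 c v w)
  show ?case
  proof (cases "v = [] \<and> w = []")
    case True
    then show ?thesis by (simp add: addc.simps carry_out_def)
  next
    case False
    then show ?thesis using 1 by (subst addc.simps) (cases v; cases w; auto)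
  qed
qed

lemma digits_addc: "digits (addc c v w)"
proof (induction c v w rule: addc.induct)
  case (1 c v w)
  then show ?case by (subst addc.simps) (auto simp: digits_def sum_bit_def)
qed

lemma digits_simps [simp]: "digits []" "digits (a # w) \<longleftrightarrow> (a = 1 \<or> a = 2) \<and> digits w"
  by (auto simp: digits_def)

lemma digits_nonzero: "digits w \<Longrightarrow> 0 \<notin> set w"
  by (auto simp: digits_def)

lemma digits_rev [simp]: "digits (rev w) = digits w"
  by (simp add: digits_def)

lemma digits_tl: "digits w \<Longrightarrow> digits (tl w)"
  by (cases w) auto

lemma digits_peek: "digits w \<Longrightarrow> peek w = 0 \<longleftrightarrow> w = []"
  by (cases w) auto

text \<open>Both operands are consumed. \<open>Tmp1\<close> collects the sum, and
  \<open>Tmp2\<close> saves \<open>Y\<close>, which has to survive as the addend for the next digit.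
  Once \<open>Y\<close> is exhausted its blank is pushed without effect, so \<open>Y\<close> regains
  its length.\<close>

definition add_loop :: "reg \<Rightarrow> reg \<Rightarrow> reg com" where
  "add_loop X Y = Loop (\<lambda>\<tau>. \<tau> X \<noteq> 0 \<or> \<tau> Y \<noteq> 0 \<or> \<tau> Carry = 2)
    (Push Tmp1 (\<lambda>\<tau>. sum_bit (\<tau> X) (\<tau> Y) (\<tau> Carry = 2)) ;; Pop Carry ;;
     Push Carry (\<lambda>\<tau>. carry_bit (\<tau> X) (\<tau> Y) (\<tau> Tmp1)) ;;
     Pop X ;; Push Tmp2 (\<lambda>\<tau>. \<tau> Y) ;; Pop Y)"

definition add :: "reg \<Rightarrow> reg \<Rightarrow> reg com" where
  "add X Y = add_loop X Y ;; Pop Carry ;; move_all Tmp1 X ;; move_all Tmp2 Y"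

text \<open>Started with an empty \<open>Carry\<close>, the loop leaves it empty if it never runs
  and otherwise with a zero digit; hence the unspecified \<open>C\<close>. One pop clears it in
  either case.\<close>

lemma exec_add_loop:
  assumes "X \<noteq> Y" "X \<notin> {Tmp1, Tmp2, Carry}" "Y \<notin> {Tmp1, Tmp2, Carry}"
  shows "s X = v \<Longrightarrow> s Y = w \<Longrightarrow> c = (peek (s Carry) = 2) \<Longrightarrow> length (s Carry) \<le> 1 \<Longrightarrow>
    digits v \<Longrightarrow> digits w \<Longrightarrow>
    \<exists>C. length C \<le> 1 \<and> exec (add_loop X Y) s (19 * length (addc c v w) + 1)
      (s(X := [], Y := [], Tmp1 := rev (addc c v w) @ s Tmp1, Tmp2 := rev w @ s Tmp2, Carry := C))"
proof (induction c v w arbitrary: s rule: addc.induct)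
  case (1 c v w)
  show ?case
  proof (cases "v = [] \<and> w = [] \<and> \<not> c")
    case True
    then show ?thesis using 1(2-5) unfolding add_loop_def
      by (intro exI [of _ "s Carry"] conjI exec_Loop_end) (auto simp: addc.simps)
  next
    case False
    have ne: "Tmp1 \<noteq> X" "Tmp2 \<noteq> X" "Carry \<noteq> X" "Tmp1 \<noteq> Y" "Tmp2 \<noteq> Y" "Carry \<noteq> Y" "Y \<noteq> X"
      using assms by auto
    define c' where "c' = carry_out (peek v) (peek w) c"
    define s1 where "s1 = s(Tmp1 := sum_bit (peek v) (peek w) c # s Tmp1, Carry := [bit_sym c'],
      X := tl v, Tmp2 := push (peek w) (s Tmp2), Y := tl w)"
    have tlC: "tl (s Carry) = []" using 1(5) by (cases "s Carry") auto
    have b: "peek (s X) \<noteq> 0 \<or> peek (s Y) \<noteq> 0 \<or> peek (s Carry) = 2"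
      using 1 False digits_peek by auto
    \<comment> \<open>The commands take 12 steps and their compositions 5; with 2 for the loop this
      gives the factor 19.\<close>
    have "exec (Push Tmp1 (\<lambda>\<tau>. sum_bit (\<tau> X) (\<tau> Y) (\<tau> Carry = 2)) ;; Pop Carry ;;
     Push Carry (\<lambda>\<tau>. carry_bit (\<tau> X) (\<tau> Y) (\<tau> Tmp1)) ;;
     Pop X ;; Push Tmp2 (\<lambda>\<tau>. \<tau> Y) ;; Pop Y) s 17 s1"
    proof (rule exec_straightI)
      have "push (bit_sym c') [] = [bit_sym c']" by simp
      with 1(2-4) show "result (Push Tmp1 (\<lambda>\<tau>. sum_bit (\<tau> X) (\<tau> Y) (\<tau> Carry = 2)) ;; Pop Carry ;;
       Push Carry (\<lambda>\<tau>. carry_bit (\<tau> X) (\<tau> Y) (\<tau> Tmp1)) ;;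
       Pop X ;; Push Tmp2 (\<lambda>\<tau>. \<tau> Y) ;; Pop Y) s = s1"
        by (simp only: result.simps fun_upd_same fun_upd_other fun_upd_apply if_True if_False ne
          ne [symmetric] reg.distinct peek_simps push_sum_bit carry_bit_sum_bit tlC
          s1_def c'_def fun_upd_upd simp_thms)
    qed simp_all
    moreover
    have "s1 X = tl v" "s1 Y = tl w" "c' = (peek (s1 Carry) = 2)" "length (s1 Carry) \<le> 1"
      by (simp_all add: s1_def ne ne [symmetric])
    from 1(1) [OF False, folded c'_def, OF this digits_tl [OF 1(6)] digits_tl [OF 1(7)]]
    obtain C where C: "length C \<le> 1" "exec (add_loop X Y) s1 (19 * length (addc c' (tl v) (tl w)) + 1)
      (s1(X := [], Y := [], Tmp1 := rev (addc c' (tl v) (tl w)) @ s1 Tmp1,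
        Tmp2 := rev (tl w) @ s1 Tmp2, Carry := C))"
      by blast
    moreover have "addc c v w = sum_bit (peek v) (peek w) c # addc c' (tl v) (tl w)"
      using False by (subst addc.simps) (simp add: c'_def)
    moreover have "rev (tl w) @ push (peek w) (s Tmp2) = rev w @ s Tmp2"
      using 1(7) by (cases w) (auto simp: push_def)
    moreover have "s1(X := [], Y := [], Tmp1 := rev (addc c' (tl v) (tl w)) @ s1 Tmp1,
        Tmp2 := rev (tl w) @ s1 Tmp2, Carry := C)
      = s(X := [], Y := [], Tmp1 := rev (addc c v w) @ s Tmp1, Tmp2 := rev w @ s Tmp2, Carry := C)"
      using assms calculation(4,5) by (auto simp: s1_def fun_eq_iff)
    ultimately have "exec (add_loop X Y) s (19 * length (addc c v w) + 1)
        (s(X := [], Y := [], Tmp1 := rev (addc c v w) @ s Tmp1, Tmp2 := rev w @ s Tmp2, Carry := C))"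
      unfolding add_loop_def using b by - (rule exec_LoopI [where s' = s1], assumption, assumption, simp, simp)
    with C(1) show ?thesis by blast
  qed
qed

lemma exec_add:
  assumes X: "X \<noteq> Y" "X \<notin> {Tmp1, Tmp2, Carry}" "Y \<notin> {Tmp1, Tmp2, Carry}"
    and s: "digits (s X)" "digits (s Y)" "s Tmp1 = []" "s Tmp2 = []" "s Carry = []"
  shows "exec (add X Y) s (40 * (max (length (s X)) (length (s Y)) + 1))
    (s(X := addc False (s X) (s Y)))"
proof -
  define z where "z = addc False (s X) (s Y)"
  obtain C where C: "length C \<le> 1" "exec (add_loop X Y) s (19 * length z + 1)
      (s(X := [], Y := [], Tmp1 := rev z, Tmp2 := rev (s Y), Carry := C))"
    using exec_add_loop [OF X, of s "s X" "s Y" False] s by (auto simp: z_def)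
  have z: "digits z" "length z \<le> max (length (s X)) (length (s Y)) + 1"
    unfolding z_def by (rule digits_addc length_addc)+
  let ?s1 = "s(X := [], Y := [], Tmp1 := rev z, Tmp2 := rev (s Y), Carry := C)"
  let ?s2 = "s(X := [], Y := [], Tmp1 := rev z, Tmp2 := rev (s Y))"
  let ?s3 = "s(X := z, Y := [], Tmp2 := rev (s Y))"
  have tlC: "tl C = []" using C(1) by (cases C) auto
  have 2: "exec (Pop Carry) ?s1 1 ?s2"
    by (rule exec_eq [OF exec_Pop]) (use s tlC X in \<open>auto simp: fun_eq_iff\<close>)
  have 3: "exec (move_all Tmp1 X) ?s2 (7 * length z + 1) ?s3"
    by (rule exec_eq [OF exec_move_all]) (use s X z digits_nonzero in \<open>auto simp: fun_eq_iff\<close>)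
  have 4: "exec (move_all Tmp2 Y) ?s3 (7 * length (s Y) + 1) (s(X := z))"
    by (rule exec_eq [OF exec_move_all]) (use s X z digits_nonzero in \<open>auto simp: fun_eq_iff\<close>)
  have "length (s Y) \<le> max (length (s X)) (length (s Y))" by simp
  with z(2) have "19 * length z + 1 + (1 + (7 * length z + 1 + (7 * length (s Y) + 1) + 1) + 1) + 1
      \<le> 40 * (max (length (s X)) (length (s Y)) + 1)"
    unfolding distrib_left by linarith
  with exec_Seq [OF C(2) exec_Seq [OF 2 exec_Seq [OF 3 4]]] show ?thesis
    unfolding add_def z_def [symmetric] by (rule exec_mono)
qed

section \<open>Multiplication by Horner's scheme\<close>

definition skip :: "reg com" where
  "skip = Push Out (\<lambda>_. 0)"

lemma exec_skip: "exec skip s 3 s"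
  unfolding skip_def by (rule exec_eq [OF exec_Push]) (auto simp: push_def)

text \<open>The least significant digit is on top and \<open>1\<close> is the digit zero, so
  prefixing it doubles.\<close>

definition horner_step :: "nat \<Rightarrow> nat list \<Rightarrow> nat list \<Rightarrow> nat list" where
  "horner_step d Y X = (if d = 2 then addc False (1 # X) Y else 1 # X)"

primrec horner :: "nat list \<Rightarrow> nat list \<Rightarrow> nat list \<Rightarrow> nat list" where
  "horner [] Y X = X"
| "horner (d # ds) Y X = horner ds Y (horner_step d Y X)"

lemma digits_horner_step: "digits X \<Longrightarrow> digits (horner_step d Y X)"
  by (simp add: horner_step_def digits_addc)

lemma length_horner_step: "length (horner_step d Y X) \<le> max (length X) (length Y) + 2"
  using length_addc [of False "1 # X" Y] by (auto simp: horner_step_def)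

lemma digits_horner: "digits X \<Longrightarrow> digits (horner ds Y X)"
  by (induction ds arbitrary: X) (auto simp: digits_horner_step)

text \<open>Crude but sufficient: in each step the doubling and a final carry add at most one digit
  each.\<close>

lemma length_horner: "length (horner ds Y X) \<le> max (length X) (length Y) + 2 * length ds"
proof (induction ds arbitrary: X)
  case (Cons d ds)
  show ?case using Cons [of "horner_step d Y X"] length_horner_step [of d Y X] by simp
qed simp

lemma val_append: "val (v @ w) = val v + 2 ^ length v * val w"
  by (induction v) (auto simp: algebra_simps)

text \<open>The accumulator is general for the induction; starting it with \<open>[]\<close> leaves
  the product. \<open>rev\<close> appears because the scheme takes the most significant digit first,
  whereas \<open>val\<close> expects it last.\<close>

lemma val_horner: "val (horner ds Y X) = val X * 2 ^ length ds + val (rev ds) * val Y"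
  by (induction ds arbitrary: X)
    (auto simp: horner_step_def val_addc val_append algebra_simps)

text \<open>The digit stays on \<open>Mkt\<close>, so that several products can use it before it is
  popped.\<close>

definition scale :: "reg \<Rightarrow> reg \<Rightarrow> reg com" where
  "scale X Y = Push X (\<lambda>_. 1) ;; Cond (\<lambda>\<tau>. \<tau> Mkt = 2) (add X Y) skip"

definition tidy :: "reg state \<Rightarrow> bool" where
  "tidy s \<longleftrightarrow> s Tmp1 = [] \<and> s Tmp2 = [] \<and> s Carry = []"

lemma exec_scale:
  assumes X: "X \<noteq> Y" "X \<notin> {Tmp1, Tmp2, Carry, Mkt}" "Y \<notin> {Tmp1, Tmp2, Carry}"
    and s: "digits (s X)" "digits (s Y)" "tidy s" "s Mkt = d # m"
    and S: "length (s X) + 1 \<le> S" "length (s Y) \<le> S"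
  shows "exec (scale X Y) s (40 * S + 46) (s(X := horner_step d (s Y) (s X)))"
proof -
  let ?s1 = "s(X := 1 # s X)"
  have neq: "X \<noteq> Tmp1" "X \<noteq> Tmp2" "X \<noteq> Carry" "X \<noteq> Mkt" using X by auto
  have "exec (Push X (\<lambda>_. 1)) s 3 ?s1"
    by (rule exec_eq [OF exec_Push]) (simp_all add: push_def)
  moreover have "exec (if d = 2 then add X Y else skip) ?s1 (40 * (S + 1)) (s(X := horner_step d (s Y) (s X)))"
  proof (cases "d = 2")
    case True
    have "exec (add X Y) ?s1 (40 * (S + 1)) (s(X := horner_step d (s Y) (s X)))"
    proof (rule exec_eq [OF exec_add])
      show "?s1(X := addc False (?s1 X) (?s1 Y)) = s(X := horner_step d (s Y) (s X))"
        using True X(1) by (simp add: horner_step_def)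
      show "40 * (max (length (?s1 X)) (length (?s1 Y)) + 1) \<le> 40 * (S + 1)"
        using S X(1) by simp
    qed (use X s neq [symmetric] in \<open>auto simp: tidy_def\<close>)
    then show ?thesis using True by simp
  next
    case False
    have "exec skip ?s1 (40 * (S + 1)) ?s1"
      by (rule exec_mono [OF exec_skip]) simp
    then show ?thesis using False by (simp add: horner_step_def)
  qed
  then have "exec (Cond (\<lambda>\<tau>. \<tau> Mkt = 2) (add X Y) skip) ?s1 (40 * S + 42) (s(X := horner_step d (s Y) (s X)))"
    using s(4) neq by - (rule exec_CondI [where t = "40 * (S + 1)"], simp_all)
  ultimately show ?thesis unfolding scale_def by (rule exec_SeqI) simp
qed

definition digit_loop :: "reg com \<Rightarrow> reg com" where
  "digit_loop c = Loop (\<lambda>\<tau>. \<tau> Mkt = 1 \<or> \<tau> Mkt = 2) (c ;; Pop Mkt)"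

lemma exec_digit_loop_scale:
  assumes X: "X \<noteq> Y" "X \<notin> {Tmp1, Tmp2, Carry, Mkt}" "Y \<notin> {Tmp1, Tmp2, Carry, Mkt}"
  shows "digits ds \<Longrightarrow> peek m \<notin> {1, 2} \<Longrightarrow> s Mkt = ds @ m \<Longrightarrow> tidy s \<Longrightarrow>
    digits (s X) \<Longrightarrow> digits (s Y) \<Longrightarrow>
    length (s X) + 2 * length ds \<le> S \<Longrightarrow> length (s Y) + 2 * length ds \<le> S \<Longrightarrow>
    exec (digit_loop (scale X Y)) s (length ds * (40 * S + 50) + 1)
      (s(Mkt := m, X := horner ds (s Y) (s X)))"
proof (induction ds arbitrary: s)
  case Nil
  then show ?case unfolding digit_loop_def by (intro exec_Loop_end) auto
next
  case (Cons d ds)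
  define s1 where "s1 = s(X := horner_step d (s Y) (s X), Mkt := ds @ m)"
  have neq: "X \<noteq> Tmp1" "X \<noteq> Tmp2" "X \<noteq> Carry" "X \<noteq> Mkt" "Y \<noteq> Mkt" using X by auto
  note neq = neq neq [symmetric]
  have 1: "exec (scale X Y) s (40 * S + 46) (s(X := horner_step d (s Y) (s X)))"
    by (rule exec_scale) (use X Cons.prems in \<open>auto\<close>)
  have 2: "exec (Pop Mkt) (s(X := horner_step d (s Y) (s X))) 1 s1"
    by (rule exec_eq [OF exec_Pop]) (use Cons.prems(3) neq in \<open>simp_all add: s1_def\<close>)
  have 3: "exec (digit_loop (scale X Y)) s1 (length ds * (40 * S + 50) + 1)
      (s1(Mkt := m, X := horner ds (s1 Y) (s1 X)))"
    \<comment> \<open>The at most two new digits are paid for by the digit just read, so the same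
      \<open>S\<close> works for the rest.\<close>
    using Cons.prems length_horner_step [of d "s Y" "s X"] X(1) neq
    by (intro Cons.IH) (auto simp: s1_def tidy_def digits_horner_step)
  have "s1(Mkt := m, X := horner ds (s1 Y) (s1 X)) = s(Mkt := m, X := horner (d # ds) (s Y) (s X))"
    using X(1) neq by (auto simp: s1_def fun_eq_iff)
  with 3 have 3: "exec (digit_loop (scale X Y)) s1 (length ds * (40 * S + 50) + 1)
      (s(Mkt := m, X := horner (d # ds) (s Y) (s X)))" by simp
  show ?case
    unfolding digit_loop_def
    by (rule exec_LoopI [OF _ exec_Seq [OF 1 2] 3 [unfolded digit_loop_def]]) (use Cons.prems in auto)
qed

text \<open>The digits of a denominator are consumed while being read, so its three products are
  computed in one pass. The results need registers of their own, since every step adds the old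
  values.\<close>

definition scale_sums :: "reg com" where
  "scale_sums = scale SumP' SumP ;; scale SumQ' SumQ ;; scale Den' Den"

lemma exec_digit_loop_scale_sums:
  "digits ds \<Longrightarrow> peek m \<notin> {1, 2} \<Longrightarrow> s Mkt = ds @ m \<Longrightarrow> tidy s \<Longrightarrow>
    (\<forall>X\<in>{SumP, SumQ, Den, SumP', SumQ', Den'}. digits (s X) \<and> length (s X) + 2 * length ds \<le> S) \<Longrightarrow>
    exec (digit_loop scale_sums) s (length ds * (120 * S + 150) + 1)
      (s(Mkt := m, SumP' := horner ds (s SumP) (s SumP'), SumQ' := horner ds (s SumQ) (s SumQ'),
         Den' := horner ds (s Den) (s Den')))"
proof (induction ds arbitrary: s)
  case Nil
  then show ?case unfolding digit_loop_def by (intro exec_Loop_end) auto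
next
  case (Cons d ds)
  define s1 where "s1 = s(SumP' := horner_step d (s SumP) (s SumP'))"
  define s2 where "s2 = s1(SumQ' := horner_step d (s SumQ) (s SumQ'))"
  define s3 where "s3 = s2(Den' := horner_step d (s Den) (s Den'))"
  define s4 where "s4 = s3(Mkt := ds @ m)"
  note defs = s4_def s3_def s2_def s1_def
  have 1: "exec (scale SumP' SumP) s (40 * S + 46) s1"
    unfolding s1_def by (rule exec_scale) (use Cons.prems in auto)
  have 2: "exec (scale SumQ' SumQ) s1 (40 * S + 46) s2"
    by (rule exec_eq [OF exec_scale [where S = S and d = d]]) (use Cons.prems in \<open>auto simp: s2_def s1_def tidy_def\<close>)
  have 3: "exec (scale Den' Den) s2 (40 * S + 46) s3"
    by (rule exec_eq [OF exec_scale [where S = S and d = d]])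
      (use Cons.prems in \<open>auto simp: s3_def s2_def s1_def tidy_def\<close>)
  have 4: "exec (Pop Mkt) s3 1 s4"
    by (rule exec_eq [OF exec_Pop]) (use Cons.prems(3) in \<open>simp_all add: defs\<close>)
  have 5: "exec (digit_loop scale_sums) s4 (length ds * (120 * S + 150) + 1)
      (s4(Mkt := m, SumP' := horner ds (s4 SumP) (s4 SumP'), SumQ' := horner ds (s4 SumQ) (s4 SumQ'),
         Den' := horner ds (s4 Den) (s4 Den')))"
    using Cons.prems length_horner_step [of d "s SumP" "s SumP'"]
      length_horner_step [of d "s SumQ" "s SumQ'"] length_horner_step [of d "s Den" "s Den'"]
    by (intro Cons.IH) (auto simp: defs tidy_def digits_horner_step)
  have "s4(Mkt := m, SumP' := horner ds (s4 SumP) (s4 SumP'), SumQ' := horner ds (s4 SumQ) (s4 SumQ'),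
         Den' := horner ds (s4 Den) (s4 Den'))
     = s(Mkt := m, SumP' := horner (d # ds) (s SumP) (s SumP'),
         SumQ' := horner (d # ds) (s SumQ) (s SumQ'), Den' := horner (d # ds) (s Den) (s Den'))"
    by (simp add: defs fun_eq_iff)
  with 5 have 5: "exec (digit_loop scale_sums) s4 (length ds * (120 * S + 150) + 1)
      (s(Mkt := m, SumP' := horner (d # ds) (s SumP) (s SumP'),
         SumQ' := horner (d # ds) (s SumQ) (s SumQ'), Den' := horner (d # ds) (s Den) (s Den')))"
    by simp
  have 6: "exec (scale_sums ;; Pop Mkt) s (120 * S + 143) s4"
    unfolding scale_sums_def
    by (rule exec_mono [OF exec_Seq [OF exec_Seq [OF 1 exec_Seq [OF 2 3]] 4]]) simp
  show ?case
    unfolding digit_loop_def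
    by (rule exec_LoopI [OF _ 6 5 [unfolded digit_loop_def]]) (use Cons.prems in auto)
qed

text \<open>Two moves by way of \<open>Tmp1\<close>, since each one reverses the word.\<close>

definition replace :: "reg \<Rightarrow> reg \<Rightarrow> reg com" where
  "replace X Y = clear X ;; move_all Y Tmp1 ;; move_all Tmp1 X"

lemma exec_replace:
  assumes X: "X \<noteq> Y" "X \<noteq> Tmp1" "Y \<noteq> Tmp1"
    and s: "digits (s X)" "digits (s Y)" "s Tmp1 = []" "length (s X) \<le> S" "length (s Y) \<le> S"
  shows "exec (replace X Y) s (17 * S + 5) (s(X := s Y, Y := []))"
proof -
  have 1: "exec (clear X) s (3 * S + 1) (s(X := []))"
    by (rule exec_mono [OF exec_clear]) (use s digits_nonzero in auto)
  have 2: "exec (move_all Y Tmp1) (s(X := [])) (7 * S + 1) (s(X := [], Y := [], Tmp1 := rev (s Y)))"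
    by (rule exec_eq [OF exec_move_all]) (use X s digits_nonzero in \<open>auto\<close>)
  have 3: "exec (move_all Tmp1 X) (s(X := [], Y := [], Tmp1 := rev (s Y))) (7 * S + 1) (s(X := s Y, Y := []))"
    by (rule exec_eq [OF exec_move_all]) (use X s digits_nonzero in \<open>auto simp: fun_eq_iff\<close>)
  show ?thesis unfolding replace_def
    by (rule exec_mono [OF exec_Seq [OF 1 exec_Seq [OF 2 3]]]) simp
qed

section \<open>The comparison program\<close>

definition accum :: "nat \<Rightarrow> nat list \<Rightarrow> nat list \<Rightarrow> nat list" where
  "accum x V N = (if x = 2 then addc False V N else V)"

lemma digits_accum: "digits V \<Longrightarrow> digits (accum x V N)"
  by (simp add: accum_def digits_addc)

lemma length_accum: "length (accum x V N) \<le> max (length V) (length N) + 1"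
  using length_addc [of False V N] by (auto simp: accum_def)

lemma val_accum: "val (accum x V N) = val V + of_bool (x = 2) * val N"
  by (simp add: accum_def val_addc)

lemma exec_accum:
  assumes X: "X \<notin> {Num, Tmp1, Tmp2, Carry}"
    and s: "digits (s X)" "digits (s Num)" "tidy s" "peek (s R) = x"
      "length (s X) \<le> S" "length (s Num) \<le> S"
  shows "exec (Cond (\<lambda>\<tau>. \<tau> R = 2) (add X Num) skip) s (40 * S + 42) (s(X := accum x (s X) (s Num)))"
proof -
  have "exec (if x = 2 then add X Num else skip) s (40 * S + 40) (s(X := accum x (s X) (s Num)))"
  proof (cases "x = 2")
    case True
    have "exec (add X Num) s (40 * S + 40) (s(X := accum x (s X) (s Num)))"
      by (rule exec_eq [OF exec_add]) (use X s True in \<open>auto simp: tidy_def accum_def\<close>)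
    then show ?thesis using True by simp
  next
    case False
    have "exec skip s (40 * S + 40) (s(X := accum x (s X) (s Num)))"
      by (rule exec_eq [OF exec_skip]) (use False in \<open>auto simp: accum_def\<close>)
    then show ?thesis using False by simp
  qed
  then show ?thesis using s(4) by - (rule exec_CondI [where t = "40 * S + 40"], simp_all)
qed

text \<open>In reverse an entry reads comma, denominator, slash, numerator. The product in
  \<open>Num\<close> uses the old \<open>Den\<close>, which is why the new denominator waits in
  \<open>Den'\<close>. The tops of \<open>Own\<close> and \<open>New\<close> tell to which sums the
  entry contributes.\<close>

definition entry :: "reg com" where
  "entry = Pop Mkt ;; digit_loop scale_sums ;; Pop Mkt ;; digit_loop (scale Num Den) ;;
     Cond (\<lambda>\<tau>. \<tau> Own = 2) (add SumP' Num) skip ;; Cond (\<lambda>\<tau>. \<tau> New = 2) (add SumQ' Num) skip ;;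
     clear Num ;; Pop Own ;; Pop New ;;
     replace SumP SumP' ;; replace SumQ SumQ' ;; replace Den Den'"

definition spare :: "reg state \<Rightarrow> bool" where
  "spare s \<longleftrightarrow> tidy s \<and> s SumP' = [] \<and> s SumQ' = [] \<and> s Den' = [] \<and> s Num = []"

text \<open>The digit loops need at most \<open>200 * (S + 1)\<close> steps per digit. The summand
  2, for comma and slash, pays for everything else, which amounts to \<open>134 * S + 117\<close>
  steps.\<close>

lemma exec_entry:
  assumes s: "s Mkt = 4 # b @ 3 # a @ m" "s Own = x # o'" "s New = y # n" "spare s"
    and dig: "digits a" "digits b" "peek m \<notin> {1, 2}" "digits (s SumP)" "digits (s SumQ)" "digits (s Den)"
    and L: "length (s SumP) \<le> L" "length (s SumQ) \<le> L" "length (s Den) \<le> L"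
    and S: "L + 2 * (length a + length b + 2) \<le> S"
  shows "exec entry s ((length a + length b + 2) * (200 * (S + 1)))
    (s(Mkt := m, Own := o', New := n, SumP := accum x (horner b (s SumP) []) (horner a (s Den) []),
       SumQ := accum y (horner b (s SumQ) []) (horner a (s Den) []), Den := horner b (s Den) []))"
proof -
  define P where "P = horner b (s SumP) []"
  define Q where "Q = horner b (s SumQ) []"
  define D where "D = horner b (s Den) []"
  define N where "N = horner a (s Den) []"
  have dPQ: "digits P" "digits Q" "digits D" "digits N"
    by (auto simp: P_def Q_def D_def N_def digits_horner)
  have lPQ: "length P \<le> L + 2 * length b" "length Q \<le> L + 2 * length b" "length D \<le> L + 2 * length b"
      "length N \<le> L + 2 * length a"
    using length_horner [of b "s SumP" "[]"] length_horner [of b "s SumQ" "[]"]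
      length_horner [of b "s Den" "[]"] length_horner [of a "s Den" "[]"] L
    by (auto simp: P_def Q_def D_def N_def)
  have lA: "length (accum x P N) \<le> S" "length (accum y Q N) \<le> S"
    using length_accum [of x P N] length_accum [of y Q N] lPQ S by auto
  have dA: "digits (accum x P N)" "digits (accum y Q N)" using dPQ digits_accum by auto
  define s1 where "s1 = s(Mkt := b @ 3 # a @ m)"
  define s2 where "s2 = s(Mkt := 3 # a @ m, SumP' := P, SumQ' := Q, Den' := D)"
  define s3 where "s3 = s(Mkt := a @ m, SumP' := P, SumQ' := Q, Den' := D)"
  define s4 where "s4 = s(Mkt := m, SumP' := P, SumQ' := Q, Den' := D, Num := N)"
  define s5 where "s5 = s(Mkt := m, SumP' := accum x P N, SumQ' := Q, Den' := D, Num := N)"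
  define s6 where "s6 = s(Mkt := m, SumP' := accum x P N, SumQ' := accum y Q N, Den' := D, Num := N)"
  define s7 where "s7 = s(Mkt := m, SumP' := accum x P N, SumQ' := accum y Q N, Den' := D)"
  define s8 where "s8 = s7(Own := o')"
  define s9 where "s9 = s8(New := n)"
  define s10 where "s10 = s9(SumP := accum x P N, SumP' := [])"
  define s11 where "s11 = s10(SumQ := accum y Q N, SumQ' := [])"
  define s12 where "s12 = s11(Den := D, Den' := [])"
  note defs = s12_def s11_def s10_def s9_def s8_def s7_def
  have e1: "exec (Pop Mkt) s 1 s1"
    by (rule exec_eq [OF exec_Pop]) (use s in \<open>simp_all add: s1_def\<close>)
  have e2: "exec (digit_loop scale_sums) s1 (length b * (120 * S + 150) + 1) s2"
    by (rule exec_eq [OF exec_digit_loop_scale_sums [where S = S and ds = b and m = "3 # a @ m"]])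
      (use s dig L S in \<open>auto simp: s1_def s2_def spare_def tidy_def P_def Q_def D_def\<close>)
  have e3: "exec (Pop Mkt) s2 1 s3"
    by (rule exec_eq [OF exec_Pop]) (auto simp: s2_def s3_def fun_eq_iff)
  have e4: "exec (digit_loop (scale Num Den)) s3 (length a * (40 * S + 50) + 1) s4"
    by (rule exec_eq [OF exec_digit_loop_scale [where S = S and ds = a and m = m]])
      (use s dig L S in \<open>auto simp: s3_def s4_def spare_def tidy_def N_def fun_eq_iff\<close>)
  have e5: "exec (Cond (\<lambda>\<tau>. \<tau> Own = 2) (add SumP' Num) skip) s4 (40 * S + 42) s5"
    by (rule exec_eq [OF exec_accum [where S = S and x = x]])
      (use s S dPQ lPQ in \<open>auto simp: s4_def s5_def spare_def tidy_def fun_eq_iff\<close>)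
  have e6: "exec (Cond (\<lambda>\<tau>. \<tau> New = 2) (add SumQ' Num) skip) s5 (40 * S + 42) s6"
    by (rule exec_eq [OF exec_accum [where S = S and x = y]])
      (use s S dPQ lPQ in \<open>auto simp: s5_def s6_def spare_def tidy_def fun_eq_iff\<close>)
  have e7: "exec (clear Num) s6 (3 * S + 1) s7"
    by (rule exec_eq [OF exec_clear])
      (use s S dPQ lPQ digits_nonzero in \<open>auto simp: s6_def s7_def spare_def fun_eq_iff\<close>)
  have e8: "exec (Pop Own) s7 1 s8"
    by (rule exec_eq [OF exec_Pop]) (use s in \<open>simp_all add: s7_def s8_def\<close>)
  have e9: "exec (Pop New) s8 1 s9"
    by (rule exec_eq [OF exec_Pop]) (use s in \<open>simp_all add: s7_def s8_def s9_def\<close>)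
  have e10: "exec (replace SumP SumP') s9 (17 * S + 5) s10"
    by (rule exec_eq [OF exec_replace [where S = S]])
      (use s S L dig dA lA in \<open>auto simp: s10_def s9_def s8_def s7_def spare_def tidy_def\<close>)
  have e11: "exec (replace SumQ SumQ') s10 (17 * S + 5) s11"
    by (rule exec_eq [OF exec_replace [where S = S]])
      (use s S L dig dA lA in \<open>auto simp: s11_def s10_def s9_def s8_def s7_def spare_def tidy_def\<close>)
  have e12: "exec (replace Den Den') s11 (17 * S + 5) s12"
    by (rule exec_eq [OF exec_replace [where S = S]])
      (use s S L dig dPQ lPQ in \<open>auto simp: defs spare_def tidy_def\<close>)
  note e = exec_Seq [OF e1 exec_Seq [OF e2 exec_Seq [OF e3 exec_Seq [OF e4 exec_Seq [OF e5
    exec_Seq [OF e6 exec_Seq [OF e7 exec_Seq [OF e8 exec_Seq [OF e9 exec_Seq [OF e10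
    exec_Seq [OF e11 e12]]]]]]]]]]]
  show ?thesis
    unfolding entry_def
  proof (rule exec_eq [OF e])
    show "s12 = s(Mkt := m, Own := o', New := n, SumP := accum x (horner b (s SumP) []) (horner a (s Den) []),
       SumQ := accum y (horner b (s SumQ) []) (horner a (s Den) []), Den := horner b (s Den) [])"
      using s(4) by (auto simp: defs P_def Q_def D_def N_def spare_def fun_eq_iff)
  qed (simp add: algebra_simps)
qed

section \<open>Rows of the utility matrix\<close>

type_synonym row = "(nat list \<times> nat list \<times> nat \<times> nat) list"

text \<open>A functional model of the loop over a row. An entry consists of the digits of
  denominator and numerator, most significant first, and of the membership digits for the given and
  the computed assignment.\<close>

fun row_sums :: "row \<Rightarrow> nat list \<times> nat list \<times> nat list \<Rightarrow> nat list \<times> nat list \<times> nat list" where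
  "row_sums [] t = t"
| "row_sums ((b, a, x, y) # es) (P, Q, D) = row_sums es
     (accum x (horner b P []) (horner a D []), accum y (horner b Q []) (horner a D []), horner b D [])"

definition row_mkt :: "row \<Rightarrow> nat list" where
  "row_mkt es = concat (map (\<lambda>(b, a, x, y). 4 # b @ 3 # a) es)"

definition row_own :: "row \<Rightarrow> nat list" where
  "row_own es = map (\<lambda>(b, a, x, y). x) es"

definition row_new :: "row \<Rightarrow> nat list" where
  "row_new es = map (\<lambda>(b, a, x, y). y) es"

definition good_row :: "row \<Rightarrow> bool" where
  "good_row es \<longleftrightarrow> (\<forall>(b, a, x, y)\<in>set es. digits a \<and> digits b)"

lemma row_simps [simp]:
  "row_mkt [] = []" "row_mkt ((b, a, x, y) # es) = 4 # b @ 3 # a @ row_mkt es"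
  "row_own [] = []" "row_own ((b, a, x, y) # es) = x # row_own es"
  "row_new [] = []" "row_new ((b, a, x, y) # es) = y # row_new es"
  "good_row []" "good_row ((b, a, x, y) # es) \<longleftrightarrow> digits a \<and> digits b \<and> good_row es"
  by (auto simp: row_mkt_def row_own_def row_new_def good_row_def)

lemma peek_row_mkt: "peek (row_mkt es @ m) = (if es = [] then peek m else 4)"
  by (cases es) auto

definition entries :: "reg com" where
  "entries = Loop (\<lambda>\<tau>. \<tau> Mkt = 4) entry"

text \<open>With an entry of length \<open>l\<close> the bound on the sums rises from
  \<open>L\<close> to \<open>L + 2 * l\<close> while the rest of the row gets shorter by
  \<open>l\<close>, so \<open>S\<close> is constant throughout the induction. The shape of the final
  sums is concluded as well because the comparison relies on it.\<close>

lemma exec_entries: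
  "s Mkt = row_mkt es @ m \<Longrightarrow> s Own = row_own es @ o' \<Longrightarrow> s New = row_new es @ n \<Longrightarrow> spare s \<Longrightarrow>
    good_row es \<Longrightarrow> peek m \<notin> {1, 2, 4} \<Longrightarrow>
    digits (s SumP) \<Longrightarrow> digits (s SumQ) \<Longrightarrow> digits (s Den) \<Longrightarrow>
    length (s SumP) \<le> L \<Longrightarrow> length (s SumQ) \<le> L \<Longrightarrow> length (s Den) \<le> L \<Longrightarrow>
    L + 2 * length (row_mkt es) \<le> S \<Longrightarrow> row_sums es (s SumP, s SumQ, s Den) = (P, Q, D) \<Longrightarrow>
    digits P \<and> digits Q \<and> digits D \<and> length P \<le> S \<and> length Q \<le> S \<and> length D \<le> S \<and>
    exec entries s (length (row_mkt es) * (202 * (S + 1)) + 1)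
      (s(Mkt := m, Own := o', New := n, SumP := P, SumQ := Q, Den := D))"
proof (induction es arbitrary: s L)
  case Nil
  then show ?case unfolding entries_def by (auto intro!: exec_Loop_end simp: fun_eq_iff)
next
  case (Cons e es)
  obtain b a x y where e: "e = (b, a, x, y)" by (cases e) auto
  define P' where "P' = accum x (horner b (s SumP) []) (horner a (s Den) [])"
  define Q' where "Q' = accum y (horner b (s SumQ) []) (horner a (s Den) [])"
  define D' where "D' = horner b (s Den) []"
  define l where "l = length a + length b + 2"
  define s1 where "s1 = s(Mkt := row_mkt es @ m, Own := row_own es @ o', New := row_new es @ n,
    SumP := P', SumQ := Q', Den := D')"
  have len: "length (row_mkt (e # es)) = l + length (row_mkt es)" by (simp add: e l_def)
  have 1: "exec entry s (l * (200 * (S + 1))) s1"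
    unfolding s1_def P'_def Q'_def D'_def l_def
    by (rule exec_entry [where L = L])
      (use Cons.prems len in \<open>auto simp: e peek_row_mkt l_def\<close>)
  have "length P' \<le> L + 2 * l" "length Q' \<le> L + 2 * l" "length D' \<le> L + 2 * l"
    using length_accum [of x "horner b (s SumP) []" "horner a (s Den) []"]
      length_accum [of y "horner b (s SumQ) []" "horner a (s Den) []"]
      length_horner [of b "s SumP" "[]"] length_horner [of b "s SumQ" "[]"]
      length_horner [of b "s Den" "[]"] length_horner [of a "s Den" "[]"] Cons.prems(10-12)
    by (auto simp: P'_def Q'_def D'_def l_def)
  then have 2: "digits P \<and> digits Q \<and> digits D \<and> length P \<le> S \<and> length Q \<le> S \<and> length D \<le> S \<and>
    exec entries s1 (length (row_mkt es) * (202 * (S + 1)) + 1)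
      (s1(Mkt := m, Own := o', New := n, SumP := P, SumQ := Q, Den := D))"
    using Cons.prems len
    by (intro Cons.IH [where L = "L + 2 * l"])
      (auto simp: s1_def e P'_def Q'_def D'_def spare_def tidy_def digits_accum digits_horner)
  have eq: "s1(Mkt := m, Own := o', New := n, SumP := P, SumQ := Q, Den := D)
      = s(Mkt := m, Own := o', New := n, SumP := P, SumQ := Q, Den := D)"
    by (simp add: s1_def fun_eq_iff)
  have "exec entries s (length (row_mkt (e # es)) * (202 * (S + 1)) + 1)
      (s(Mkt := m, Own := o', New := n, SumP := P, SumQ := Q, Den := D))"
    unfolding entries_def
  proof (rule exec_LoopI [OF _ 1])
    show "exec (Loop (\<lambda>\<tau>. \<tau> Mkt = 4) entry) s1 (length (row_mkt es) * (202 * (S + 1)) + 1)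
      (s(Mkt := m, Own := o', New := n, SumP := P, SumQ := Q, Den := D))"
      using 2 unfolding entries_def eq by blast
    \<comment> \<open>The two steps of loop overhead per entry turn the factor 200 into 202.\<close>
    have "2 \<le> l * (2 * (S + 1))" by (simp add: l_def)
    then show "l * (200 * (S + 1)) + (length (row_mkt es) * (202 * (S + 1)) + 1) + 2
        \<le> length (row_mkt (e # es)) * (202 * (S + 1)) + 1"
      unfolding len by (simp add: algebra_simps)
  qed (use Cons.prems in \<open>simp add: e\<close>)
  with 2 show ?case by blast
qed

text \<open>Both words are always read to the end, and every differing position leaves a mark on
  \<open>Diff\<close>, which is kept from row to row. Testing for the digit \<open>2\<close>
  identifies zeros with blanks, so unequal lengths are no problem.\<close>

definition compare :: "reg com" where
  "compare = Loop (\<lambda>\<tau>. \<tau> SumP \<noteq> 0 \<or> \<tau> SumQ \<noteq> 0)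
     (Push Diff (\<lambda>\<tau>. if (\<tau> SumP = 2) = (\<tau> SumQ = 2) then 0 else 1) ;; Pop SumP ;; Pop SumQ)"

lemma exec_compare:
  "digits (s SumP) \<Longrightarrow> digits (s SumQ) \<Longrightarrow> length (s SumP) \<le> S \<Longrightarrow> length (s SumQ) \<le> S \<Longrightarrow>
    0 \<notin> set (s Diff) \<Longrightarrow>
    \<exists>d. exec compare s (9 * S + 1) (s(SumP := [], SumQ := [], Diff := d)) \<and> 0 \<notin> set d \<and>
      (d = [] \<longleftrightarrow> s Diff = [] \<and> val (s SumP) = val (s SumQ))"
proof (induction S arbitrary: s)
  case 0
  then show ?case unfolding compare_def
    by (intro exI [of _ "s Diff"] conjI exec_Loop_end) (auto simp: fun_eq_iff)
next
  case (Suc S)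
  show ?case
  proof (cases "s SumP = [] \<and> s SumQ = []")
    case True
    with Suc.prems show ?thesis unfolding compare_def
      by (intro exI [of _ "s Diff"] conjI exec_Loop_end) (auto simp: fun_eq_iff)
  next
    case False
    define d0 where "d0 = (if (peek (s SumP) = 2) = (peek (s SumQ) = 2) then s Diff else 1 # s Diff)"
    define s1 where "s1 = s(Diff := d0, SumP := tl (s SumP), SumQ := tl (s SumQ))"
    have "exec (Push Diff (\<lambda>\<tau>. if (\<tau> SumP = 2) = (\<tau> SumQ = 2) then 0 else 1) ;; Pop SumP ;; Pop SumQ) s 7 s1"
      by (rule exec_straightI) (simp_all add: s1_def d0_def push_def)
    moreover have "digits (s1 SumP)" "digits (s1 SumQ)" "length (s1 SumP) \<le> S" "length (s1 SumQ) \<le> S"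
      "0 \<notin> set (s1 Diff)"
      using Suc.prems by (simp_all add: s1_def d0_def digits_tl)
    from Suc.IH [OF this]
    obtain d where d: "exec compare s1 (9 * S + 1) (s1(SumP := [], SumQ := [], Diff := d))"
      "0 \<notin> set d" "d = [] \<longleftrightarrow> s1 Diff = [] \<and> val (s1 SumP) = val (s1 SumQ)"
      by blast
    moreover have "s1(SumP := [], SumQ := [], Diff := d) = s(SumP := [], SumQ := [], Diff := d)"
      by (simp add: s1_def fun_eq_iff)
    moreover have "peek (s SumP) \<noteq> 0 \<or> peek (s SumQ) \<noteq> 0"
      using False Suc.prems digits_peek by auto
    ultimately have "exec compare s (9 * Suc S + 1) (s(SumP := [], SumQ := [], Diff := d))"
      unfolding compare_def by - (rule exec_LoopI [where s' = s1 and t = 7 and t' = "9 * S + 1"], simp_all)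
    moreover have "d = [] \<longleftrightarrow> s Diff = [] \<and> val (s SumP) = val (s SumQ)"
    proof -
      \<comment> \<open>The lowest digit is the parity, so equality splits into equal parities and
        equal halves.\<close>
      have "val (s SumP) = val (s SumQ) \<longleftrightarrow> (peek (s SumP) = 2) = (peek (s SumQ) = 2) \<and>
          val (tl (s SumP)) = val (tl (s SumQ))"
        unfolding val_unfold [of "s SumP"] val_unfold [of "s SumQ"] by (auto; presburger)
      then show ?thesis using d(3) by (auto simp: s1_def d0_def)
    qed
    ultimately show ?thesis using d(2) by blast
  qed
qed

definition row_com :: "reg com" where
  "row_com = Pop Mkt ;; Pop Own ;; Pop New ;; Push Den (\<lambda>_. 2) ;; entries ;; compare ;; clear Den"

text \<open>\<open>[2]\<close> is the number one, so both sums start as 0/1. They keep a common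
  denominator, hence numerators suffice.\<close>

definition balanced :: "row \<Rightarrow> bool" where
  "balanced es \<longleftrightarrow> (case row_sums es ([], [], [2]) of (P, Q, D) \<Rightarrow> val P = val Q)"

definition idle :: "reg state \<Rightarrow> bool" where
  "idle s \<longleftrightarrow> spare s \<and> s SumP = [] \<and> s SumQ = [] \<and> s Den = []"

lemma exec_row_com:
  assumes s: "s Mkt = 5 # row_mkt es @ m" "s Own = 5 # row_own es @ o'" "s New = 5 # row_new es @ n"
      "idle s" "0 \<notin> set (s Diff)"
    and es: "good_row es" "peek m \<notin> {1, 2, 4}"
    and S: "1 + 2 * length (row_mkt es) \<le> S"
  shows "\<exists>d. exec row_com s ((length (row_mkt es) + 1) * (250 * (S + 1)))
      (s(Mkt := m, Own := o', New := n, Diff := d)) \<and> 0 \<notin> set d \<and>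
      (d = [] \<longleftrightarrow> s Diff = [] \<and> balanced es)"
proof -
  obtain P Q D where sums: "row_sums es ([], [], [2]) = (P, Q, D)" by (metis prod_cases3)
  define s1 where "s1 = s(Mkt := row_mkt es @ m)"
  define s2 where "s2 = s1(Own := row_own es @ o')"
  define s3 where "s3 = s2(New := row_new es @ n)"
  define s4 where "s4 = s3(Den := [2])"
  define s5 where "s5 = s(Mkt := m, Own := o', New := n, SumP := P, SumQ := Q, Den := D)"
  note defs = s4_def s3_def s2_def s1_def
  have e1: "exec (Pop Mkt) s 1 s1"
    by (rule exec_eq [OF exec_Pop]) (use s in \<open>simp_all add: s1_def\<close>)
  have e2: "exec (Pop Own) s1 1 s2"
    by (rule exec_eq [OF exec_Pop]) (use s in \<open>simp_all add: s2_def s1_def\<close>)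
  have e3: "exec (Pop New) s2 1 s3"
    by (rule exec_eq [OF exec_Pop]) (use s in \<open>simp_all add: s3_def s2_def s1_def\<close>)
  have e4: "exec (Push Den (\<lambda>_. 2)) s3 3 s4"
    by (rule exec_eq [OF exec_Push]) (use s in \<open>simp_all add: defs push_def idle_def\<close>)
  have e5: "digits P \<and> digits Q \<and> digits D \<and> length P \<le> S \<and> length Q \<le> S \<and> length D \<le> S \<and>
    exec entries s4 (length (row_mkt es) * (202 * (S + 1)) + 1)
      (s4(Mkt := m, Own := o', New := n, SumP := P, SumQ := Q, Den := D))"
    by (rule exec_entries [where L = 1])
      (use s es S sums in \<open>auto simp: defs idle_def spare_def tidy_def\<close>)
  moreover have "s4(Mkt := m, Own := o', New := n, SumP := P, SumQ := Q, Den := D) = s5"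
    by (auto simp: defs s5_def fun_eq_iff)
  ultimately have e5: "exec entries s4 (length (row_mkt es) * (202 * (S + 1)) + 1) s5"
    and PQ: "digits P" "digits Q" "digits D" "length P \<le> S" "length Q \<le> S" "length D \<le> S"
    by auto
  have "digits (s5 SumP)" "digits (s5 SumQ)" "length (s5 SumP) \<le> S" "length (s5 SumQ) \<le> S"
      "0 \<notin> set (s5 Diff)"
    using PQ s by (simp_all add: s5_def)
  note cmp = exec_compare [OF this]
  have "s5 SumP = P" "s5 SumQ = Q" "s5 Diff = s Diff" by (simp_all add: s5_def)
  moreover have "balanced es \<longleftrightarrow> val P = val Q" by (simp add: balanced_def sums)
  ultimately obtain d where d: "exec compare s5 (9 * S + 1) (s5(SumP := [], SumQ := [], Diff := d))"
    "0 \<notin> set d" "d = [] \<longleftrightarrow> s Diff = [] \<and> balanced es"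
    using cmp by metis
  define s6 where "s6 = s5(SumP := [], SumQ := [], Diff := d)"
  have e6: "exec compare s5 (9 * S + 1) s6" using d(1) by (simp add: s6_def)
  have e7: "exec (clear Den) s6 (3 * S + 1) (s(Mkt := m, Own := o', New := n, Diff := d))"
    by (rule exec_eq [OF exec_clear])
      (use s PQ digits_nonzero in \<open>auto simp: s6_def s5_def idle_def fun_eq_iff\<close>)
  note e = exec_Seq [OF e1 exec_Seq [OF e2 exec_Seq [OF e3 exec_Seq [OF e4 exec_Seq [OF e5
    exec_Seq [OF e6 e7]]]]]]
  have "exec row_com s ((length (row_mkt es) + 1) * (250 * (S + 1)))
      (s(Mkt := m, Own := o', New := n, Diff := d))"
    unfolding row_com_def by (rule exec_mono [OF e]) (simp add: algebra_simps)
  with d show ?thesis by blast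
qed

text \<open>A semicolon ends each row of an encoding, so it comes first when read backwards.\<close>

definition table :: "(row \<Rightarrow> nat list) \<Rightarrow> row list \<Rightarrow> nat list" where
  "table f rows = concat (map (\<lambda>es. 5 # f es) rows)"

lemma table_simps [simp]: "table f [] = []" "table f (es # rows) = 5 # f es @ table f rows"
  by (simp_all add: table_def)

definition rows_com :: "reg com" where
  "rows_com = Loop (\<lambda>\<tau>. \<tau> Mkt = 5) row_com"

lemma exec_rows_com:
  "s Mkt = table row_mkt rows \<Longrightarrow> s Own = table row_own rows \<Longrightarrow> s New = table row_new rows \<Longrightarrow>
    idle s \<Longrightarrow> 0 \<notin> set (s Diff) \<Longrightarrow> \<forall>es\<in>set rows. good_row es \<Longrightarrow>
    1 + 2 * length (table row_mkt rows) \<le> S \<Longrightarrow>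
    \<exists>d. exec rows_com s (length (table row_mkt rows) * (252 * (S + 1)) + 1)
      (s(Mkt := [], Own := [], New := [], Diff := d)) \<and> 0 \<notin> set d \<and>
      (d = [] \<longleftrightarrow> s Diff = [] \<and> (\<forall>es\<in>set rows. balanced es))"
proof (induction rows arbitrary: s)
  case Nil
  then show ?case unfolding rows_com_def
    by (intro exI [of _ "s Diff"] conjI exec_Loop_end) (auto simp: fun_eq_iff)
next
  case (Cons es rows)
  define l where "l = length (row_mkt es) + 1"
  have len: "length (table row_mkt (es # rows)) = l + length (table row_mkt rows)" by (simp add: l_def)
  have peek: "peek (table row_mkt rows) \<notin> {1, 2, 4}" by (cases rows) auto
  from exec_row_com [of s es "table row_mkt rows" "table row_own rows" "table row_new rows" S] Cons.prems peek
  obtain d where d: "exec row_com s (l * (250 * (S + 1)))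
      (s(Mkt := table row_mkt rows, Own := table row_own rows, New := table row_new rows, Diff := d))"
    "0 \<notin> set d" "d = [] \<longleftrightarrow> s Diff = [] \<and> balanced es"
    by (auto simp: l_def)
  define s1 where
    "s1 = s(Mkt := table row_mkt rows, Own := table row_own rows, New := table row_new rows, Diff := d)"
  have "s1 Mkt = table row_mkt rows" "s1 Own = table row_own rows" "s1 New = table row_new rows"
    "idle s1" "0 \<notin> set (s1 Diff)" "\<forall>es\<in>set rows. good_row es"
    "1 + 2 * length (table row_mkt rows) \<le> S"
    using Cons.prems d(2) by (auto simp: s1_def idle_def spare_def tidy_def)
  moreover have "s1 Diff = d" by (simp add: s1_def)
  ultimately
  obtain d' where d': "exec rows_com s1 (length (table row_mkt rows) * (252 * (S + 1)) + 1)
      (s1(Mkt := [], Own := [], New := [], Diff := d'))"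
      "0 \<notin> set d'" "d' = [] \<longleftrightarrow> d = [] \<and> (\<forall>es\<in>set rows. balanced es)"
    using Cons.IH [of s1] by metis
  have eq: "s1(Mkt := [], Own := [], New := [], Diff := d') = s(Mkt := [], Own := [], New := [], Diff := d')"
    by (simp add: s1_def fun_eq_iff)
  have "exec rows_com s (length (table row_mkt (es # rows)) * (252 * (S + 1)) + 1)
      (s(Mkt := [], Own := [], New := [], Diff := d'))"
    unfolding rows_com_def
  proof (rule exec_LoopI)
    show "exec row_com s (l * (250 * (S + 1))) s1" using d(1) by (simp add: s1_def)
    show "exec (Loop (\<lambda>\<tau>. \<tau> Mkt = 5) row_com) s1 (length (table row_mkt rows) * (252 * (S + 1)) + 1)
      (s(Mkt := [], Own := [], New := [], Diff := d'))"
      using d'(1) unfolding eq rows_com_def .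
    show "l * (250 * (S + 1)) + (length (table row_mkt rows) * (252 * (S + 1)) + 1) + 2
        \<le> length (table row_mkt (es # rows)) * (252 * (S + 1)) + 1"
      unfolding len by (simp add: l_def algebra_simps)
  qed (use Cons.prems in simp)
  moreover have "d' = [] \<longleftrightarrow> s Diff = [] \<and> (\<forall>es\<in>set (es # rows). balanced es)"
    using d(3) d'(3) by auto
  ultimately show ?case using d'(2) by blast
qed

text \<open>Each move leaves the last symbol of its encoding on top. The first one stops at the hash
  between market and assignment.\<close>

definition check_com :: "reg com" where
  "check_com = move_while (\<lambda>a. a \<noteq> 0 \<and> a \<noteq> 6) Src Mkt ;; Pop Src ;; move_all Src Own ;; move_all In New ;;
     rows_com ;; Push Out (\<lambda>\<tau>. if \<tau> Diff = 0 then 2 else 1)"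

lemma exec_check_com:
  assumes rows: "rev mkt = table row_mkt rows" "rev own = table row_own rows" "rev new = table row_new rows"
      "\<forall>es\<in>set rows. good_row es"
    and syms: "0 \<notin> set mkt" "6 \<notin> set mkt" "0 \<notin> set own" "0 \<notin> set new"
    and N: "length mkt + 1 + length own \<le> N" "length new \<le> N"
  shows "\<exists>s'. exec check_com ((\<lambda>_. [])(In := new, Src := mkt @ 6 # own)) (600 * (N + 1) ^ 2) s' \<and>
     s' Out = enc_bool (\<forall>es\<in>set rows. balanced es)"
proof -
  define s where "s = (\<lambda>_. [])(In := new, Src := mkt @ 6 # own)"
  define s1 where "s1 = s(Src := 6 # own, Mkt := rev mkt)"
  define s2 where "s2 = s1(Src := own)"
  define s3 where "s3 = s2(Src := [], Own := rev own)"
  define s4 where "s4 = s3(In := [], New := rev new)"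
  note defs = s4_def s3_def s2_def s1_def s_def
  have e1: "exec (move_while (\<lambda>a. a \<noteq> 0 \<and> a \<noteq> 6) Src Mkt) s (7 * length mkt + 1) s1"
    by (rule exec_eq [OF exec_move_while [where u = mkt and v = "6 # own"]])
      (use syms in \<open>auto simp: s1_def s_def intro: ccontr\<close>)
  have e2: "exec (Pop Src) s1 1 s2"
    by (rule exec_eq [OF exec_Pop]) (simp_all add: s2_def s1_def)
  have e3: "exec (move_all Src Own) s2 (7 * length own + 1) s3"
    by (rule exec_eq [OF exec_move_all]) (use syms in \<open>simp_all add: s3_def s2_def s1_def s_def\<close>)
  have e4: "exec (move_all In New) s3 (7 * length new + 1) s4"
    by (rule exec_eq [OF exec_move_all]) (use syms in \<open>simp_all add: defs\<close>)
  define l where "l = length (table row_mkt rows)"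
  have l: "l \<le> N" using N rows(1) by (metis add_leD1 l_def length_rev)
  have "s4 Mkt = table row_mkt rows" "s4 Own = table row_own rows" "s4 New = table row_new rows"
    "idle s4" "0 \<notin> set (s4 Diff)" "\<forall>es\<in>set rows. good_row es" "1 + 2 * l \<le> 1 + 2 * N"
    using rows l by (auto simp: defs idle_def spare_def tidy_def)
  note all = exec_rows_com [OF this(1-6) this(7) [unfolded l_def]]
  have "s4 Diff = []" by (simp add: defs)
  then obtain d where d: "exec rows_com s4 (l * (252 * (1 + 2 * N + 1)) + 1)
      (s4(Mkt := [], Own := [], New := [], Diff := d))"
      "0 \<notin> set d" "d = [] \<longleftrightarrow> (\<forall>es\<in>set rows. balanced es)"
    using all unfolding l_def by metis
  define s5 where "s5 = s4(Mkt := [], Own := [], New := [], Diff := d)"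
  define s6 where "s6 = s5(Out := [if peek d = 0 then 2 else 1])"
  have e5: "exec rows_com s4 (l * (252 * (1 + 2 * N + 1)) + 1) s5" using d by (simp add: s5_def)
  have e6: "exec (Push Out (\<lambda>\<tau>. if \<tau> Diff = 0 then 2 else 1)) s5 3 s6"
    by (rule exec_eq [OF exec_Push]) (auto simp: s6_def s5_def defs push_def)
  have "exec check_com s (600 * (N + 1) ^ 2) s6"
    unfolding check_com_def
  proof (rule exec_mono [OF exec_Seq [OF e1 exec_Seq [OF e2 exec_Seq [OF e3 exec_Seq [OF e4
        exec_Seq [OF e5 e6]]]]]])
    \<comment> \<open>The rows are processed with \<open>1 + 2 * N\<close> as the bound on lengths,
      for at most \<open>N\<close> symbols; this is the quadratic part.\<close>
    have "l * (252 * (1 + 2 * N + 1)) \<le> N * (252 * (1 + 2 * N + 1))" using l by simp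
    also have "\<dots> = 504 * (N * N) + 504 * N" by (simp add: algebra_simps)
    finally show "7 * length mkt + 1 + (1 + (7 * length own + 1 + (7 * length new + 1 +
        (l * (252 * (1 + 2 * N + 1)) + 1 + 3 + 1) + 1) + 1) + 1) + 1 \<le> 600 * (N + 1) ^ 2"
      using N by (simp add: power2_eq_square algebra_simps)
  qed
  moreover have "peek d = 0 \<longleftrightarrow> d = []" using d(2) by (cases d) auto
  then have "s6 Out = enc_bool (\<forall>es\<in>set rows. balanced es)"
    using d(3) by (auto simp: s6_def enc_bool_def)
  ultimately show ?thesis unfolding s_def by blast
qed

section \<open>Duplicating the input\<close>

definition copy_com :: "reg com" where
  "copy_com = move_all In Tmp1 ;;
     Loop (\<lambda>\<tau>. \<tau> Tmp1 \<noteq> 0) (Push In (\<lambda>\<tau>. \<tau> Tmp1) ;; Push Src (\<lambda>\<tau>. \<tau> Tmp1) ;; Pop Tmp1)"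

lemma exec_copy_com:
  assumes "0 \<notin> set w"
  shows "exec copy_com ((\<lambda>_. [])(In := w)) (18 * length w + 3) ((\<lambda>_. [])(In := w, Src := w))"
proof -
  \<comment> \<open>Unloading \<open>Tmp1\<close> undoes the first reversal in both copies.\<close>
  have loop: "0 \<notin> set u \<Longrightarrow> s Tmp1 = u \<Longrightarrow>
    exec (Loop (\<lambda>\<tau>. \<tau> Tmp1 \<noteq> 0) (Push In (\<lambda>\<tau>. \<tau> Tmp1) ;; Push Src (\<lambda>\<tau>. \<tau> Tmp1) ;; Pop Tmp1))
      s (11 * length u + 1) (s(Tmp1 := [], In := rev u @ s In, Src := rev u @ s Src))" for u s
  proof (induction u arbitrary: s)
    case Nil
    then show ?case by (intro exec_Loop_end) auto
  next
    case (Cons a u)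
    define s1 where "s1 = s(In := a # s In, Src := a # s Src, Tmp1 := u)"
    have 1: "exec (Push In (\<lambda>\<tau>. \<tau> Tmp1) ;; Push Src (\<lambda>\<tau>. \<tau> Tmp1) ;; Pop Tmp1) s 9 s1"
      by (rule exec_straightI) (use Cons.prems in \<open>simp_all add: s1_def push_def\<close>)
    have 2: "exec (Loop (\<lambda>\<tau>. \<tau> Tmp1 \<noteq> 0) (Push In (\<lambda>\<tau>. \<tau> Tmp1) ;; Push Src (\<lambda>\<tau>. \<tau> Tmp1) ;; Pop Tmp1))
      s1 (11 * length u + 1) (s(Tmp1 := [], In := rev (a # u) @ s In, Src := rev (a # u) @ s Src))"
      by (rule exec_eq [OF Cons.IH]) (use Cons.prems in \<open>auto simp: s1_def fun_eq_iff\<close>)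
    show ?case
      by (rule exec_LoopI [OF _ 1 2]) (use Cons.prems in simp_all)
  qed
  let ?s = "(\<lambda>_. [])(In := w)"
  have 1: "exec (move_all In Tmp1) ?s (7 * length w + 1) ((\<lambda>_. [])(Tmp1 := rev w))"
    by (rule exec_eq [OF exec_move_all]) (use assms in \<open>simp_all add: fun_eq_iff\<close>)
  show ?thesis unfolding copy_com_def
    by (rule exec_eq [OF exec_Seq [OF 1 loop [of "rev w"]]]) (use assms in \<open>auto simp: fun_eq_iff\<close>)
qed

section \<open>Comparing bundles by their encodings\<close>

text \<open>\<open>sel\<close> chooses between the two assignments; \<open>rev\<close> restores the
  digit order that \<open>val\<close> expects.\<close>

definition amount :: "(nat \<times> nat \<Rightarrow> nat) \<Rightarrow> row \<Rightarrow> rat" where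
  "amount sel es = (\<Sum>(b, a, xy)\<leftarrow>es.
     if sel xy = 2 then of_nat (val (rev a)) / of_nat (val (rev b)) else 0)"

text \<open>Addition of fractions without reduction:
  \<open>P / D + a / b = (b * P + a * D) / (b * D)\<close>. Positivity of the denominator belongs to
  the invariant, since it justifies the cancelling.\<close>

lemma row_sums_value:
  "\<forall>(b, a, xy)\<in>set es. 0 < val (rev b) \<Longrightarrow> 0 < val D \<Longrightarrow> row_sums es (P, Q, D) = (P', Q', D') \<Longrightarrow>
    0 < val D' \<and>
    rat_of_nat (val P') / of_nat (val D') = of_nat (val P) / of_nat (val D) + amount fst es \<and>
    rat_of_nat (val Q') / of_nat (val D') = of_nat (val Q) / of_nat (val D) + amount snd es"
proof (induction es arbitrary: P Q D)
  case Nil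
  then show ?case by (simp add: amount_def)
next
  case (Cons e es)
  obtain b a x y where e: "e = (b, a, x, y)" by (cases e) auto
  let ?P = "accum x (horner b P []) (horner a D [])"
  let ?Q = "accum y (horner b Q []) (horner a D [])"
  let ?D = "horner b D []"
  have b: "0 < val (rev b)" using Cons.prems(1) e by simp
  have pos: "0 < val ?D" using b Cons.prems(2) by (simp add: val_horner)
  have "rat_of_nat (val ?P) / of_nat (val ?D) = of_nat (val P) / of_nat (val D) +
      (if x = 2 then of_nat (val (rev a)) / of_nat (val (rev b)) else 0)"
    "rat_of_nat (val ?Q) / of_nat (val ?D) = of_nat (val Q) / of_nat (val D) +
      (if y = 2 then of_nat (val (rev a)) / of_nat (val (rev b)) else 0)"
    using b Cons.prems(2) by (auto simp: val_horner val_accum field_simps)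
  then show ?case
    using Cons.IH [OF _ pos, of ?P ?Q] Cons.prems(1,3) by (simp add: e amount_def)
qed

lemma balanced_iff:
  assumes "\<forall>(b, a, xy)\<in>set es. 0 < val (rev b)"
  shows "balanced es \<longleftrightarrow> amount fst es = amount snd es"
proof -
  obtain P Q D where sums: "row_sums es ([], [], [2]) = (P, Q, D)" by (metis prod_cases3)
  from row_sums_value [OF assms _ this]
  have "0 < val D" "amount fst es = of_nat (val P) / of_nat (val D)"
    "amount snd es = of_nat (val Q) / of_nat (val D)" by simp_all
  then show ?thesis by (simp add: balanced_def sums)
qed

lemma enc_nat_digits: "digits (enc_nat n) \<and> val (enc_nat n) = n"
proof (induction n rule: enc_nat.induct)
  case (1 n)
  then show ?case by (subst (1 2) enc_nat.simps) (auto simp: enc_bool_def)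
qed

definition entry_of :: "market \<Rightarrow> (nat \<Rightarrow> nat set) \<Rightarrow> (nat \<Rightarrow> nat set) \<Rightarrow> nat \<Rightarrow> nat \<Rightarrow>
    nat list \<times> nat list \<times> nat \<times> nat" where
  "entry_of I p q i j = (case quotient_of (util I i j) of (a, b) \<Rightarrow>
     (rev (enc_nat (nat b)), rev (enc_nat (nat a)), bit_sym (j \<in> p i), bit_sym (j \<in> q i)))"

definition row_of :: "market \<Rightarrow> (nat \<Rightarrow> nat set) \<Rightarrow> (nat \<Rightarrow> nat set) \<Rightarrow> nat \<Rightarrow> row" where
  "row_of I p q i = map (entry_of I p q i) (rev [1..<num_objects I + 1])"

definition rows_of :: "market \<Rightarrow> (nat \<Rightarrow> nat set) \<Rightarrow> (nat \<Rightarrow> nat set) \<Rightarrow> row list" where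
  "rows_of I p q = map (row_of I p q) (rev [1..<num_agents I + 1])"

text \<open>Reversal also lists agents and objects in descending order, which is harmless: neither
  the sums over objects nor the conjunction over agents depends on the order.\<close>

lemma rev_enc_market: "rev (enc_market I) = table row_mkt (rows_of I p q)"
  by (simp add: enc_market_def table_def rows_of_def row_of_def row_mkt_def rev_concat rev_map
      comp_def entry_of_def enc_rat_def case_prod_unfold del: upt_Suc)

lemma rev_enc_assignment:
  "rev (enc_assignment I p) = table row_own (rows_of I p q)"
  "rev (enc_assignment I q) = table row_new (rows_of I p q)"
  by (simp_all add: enc_assignment_def table_def rows_of_def row_of_def row_own_def row_new_def rev_concat
      rev_map comp_def entry_of_def enc_bool_def bit_sym_def case_prod_unfold del: upt_Suc)

lemma good_rows_of: "es \<in> set (rows_of I p q) \<Longrightarrow> good_row es"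
  using enc_nat_digits by (auto simp: rows_of_def row_of_def good_row_def entry_of_def case_prod_unfold)

lemma amount_row_of:
  assumes "wf_market I" "i \<in> agents I" "S \<subseteq> objects I"
    and sel: "\<And>j. sel (bit_sym (j \<in> p i), bit_sym (j \<in> q i)) = bit_sym (j \<in> S)"
  shows "amount sel (row_of I p q i) = bundle_util I i S"
proof -
  have e: "(case entry_of I p q i j of (b, a, xy) \<Rightarrow>
      if sel xy = 2 then rat_of_nat (val (rev a)) / of_nat (val (rev b)) else 0)
    = (if j \<in> S then util I i j else 0)" if "j \<in> objects I" for j
  proof -
    obtain a b where ab: "quotient_of (util I i j) = (a, b)" by force
    have u: "util I i j = of_int a / of_int b" "0 < b"
      using quotient_of_div [OF ab] quotient_of_denom_pos [OF ab] by auto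
    have "0 \<le> util I i j" using assms that by (simp add: wf_market_def)
    \<comment> \<open>The encoding passes through \<open>nat\<close>, which loses nothing for a
      nonnegative numerator.\<close>
    then have "0 \<le> a" using u by (simp add: zero_le_divide_iff)
    then have "rat_of_nat (nat a) = of_int a" "rat_of_nat (nat b) = of_int b" using u(2) by simp_all
    then show ?thesis using enc_nat_digits by (simp add: entry_of_def ab sel u(1) [symmetric])
  qed
  have "amount sel (row_of I p q i) = (\<Sum>j\<leftarrow>rev [1..<num_objects I + 1]. if j \<in> S then util I i j else 0)"
    unfolding amount_def row_of_def map_map
    by (intro arg_cong [of _ _ sum_list] map_cong) (use e in \<open>auto simp: objects_def\<close>)
  also have "\<dots> = (\<Sum>j\<in>objects I. if j \<in> S then util I i j else 0)"
    by (subst sum_list_distinct_conv_sum_set)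
      (auto simp: objects_def atLeastLessThanSuc_atLeastAtMost simp del: upt_Suc)
  also have "\<dots> = bundle_util I i S"
    unfolding bundle_util_def using assms(3) by (subst sum.inter_restrict [symmetric])
      (auto simp: objects_def Int_absorb1)
  finally show ?thesis .
qed

lemma balanced_row_of:
  assumes "wf_market I" "assignment I p" "assignment I q" "i \<in> agents I"
  shows "balanced (row_of I p q i) \<longleftrightarrow> bundle_util I i (p i) = bundle_util I i (q i)"
proof -
  have "p i \<subseteq> objects I" "q i \<subseteq> objects I" using assms by (auto simp: assignment_def)
  then have "amount fst (row_of I p q i) = bundle_util I i (p i)"
    "amount snd (row_of I p q i) = bundle_util I i (q i)"
    using amount_row_of [OF assms(1,4)] by auto
  moreover have "\<forall>(b, a, xy)\<in>set (row_of I p q i). 0 < val (rev b)"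
    using enc_nat_digits quotient_of_denom_pos'
    by (auto simp: row_of_def entry_of_def case_prod_unfold)
  ultimately show ?thesis by (simp add: balanced_iff)
qed

text \<open>A strict gain of some agent would make \<open>q\<close> dominate \<open>p\<close>; and
  if all utilities agree, exactly the same assignments dominate \<open>p\<close> and
  \<open>q\<close>.\<close>

lemma pareto_optimal_iff_indifferent:
  assumes "assignment I q" "pareto_optimal I q" "individually_rational I p q"
  shows "pareto_optimal I p \<longleftrightarrow> (\<forall>i\<in>agents I. bundle_util I i (p i) = bundle_util I i (q i))"
proof
  assume "pareto_optimal I p"
  then show "\<forall>i\<in>agents I. bundle_util I i (p i) = bundle_util I i (q i)"
    using assms unfolding pareto_optimal_def pareto_dominates_def individually_rational_def
    by (metis order_le_imp_less_or_eq)
next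
  assume "\<forall>i\<in>agents I. bundle_util I i (p i) = bundle_util I i (q i)"
  then show "pareto_optimal I p"
    using assms unfolding pareto_optimal_def pareto_dominates_def by auto
qed

section \<open>The deciding machine\<close>

text \<open>\<open>In\<close> comes first in order to fall on the last tape of the assumed machine,
  where its answer stands; \<open>Out\<close> comes last because outputs are read off the last tape.
  Of the 17 registers only \<open>In\<close> shares a tape with that machine, hence
  \<open>l + 16\<close> tapes.\<close>

definition reg_index :: "reg \<Rightarrow> nat" where
  "reg_index r = (case r of In \<Rightarrow> 0 | Src \<Rightarrow> 1 | Mkt \<Rightarrow> 2 | Own \<Rightarrow> 3 | New \<Rightarrow> 4 | SumP \<Rightarrow> 5 | SumQ \<Rightarrow> 6
     | Den \<Rightarrow> 7 | SumP' \<Rightarrow> 8 | SumQ' \<Rightarrow> 9 | Den' \<Rightarrow> 10 | Num \<Rightarrow> 11 | Tmp1 \<Rightarrow> 12 | Tmp2 \<Rightarrow> 13 | Carry \<Rightarrow> 14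
     | Diff \<Rightarrow> 15 | Out \<Rightarrow> 16)"

lemma inj_reg_index: "reg_index r = reg_index r' \<Longrightarrow> r = r'"
  by (cases r; cases r'; simp add: reg_index_def)

lemma reg_index_le: "reg_index r \<le> 16"
  by (cases r; simp add: reg_index_def)

lemma reg_index_eq_0: "reg_index r = 0 \<longleftrightarrow> r = In"
  by (cases r; simp add: reg_index_def)

lemma wf_com_move_while: "X \<noteq> Z \<Longrightarrow> wf_com n (move_while p X Z)"
  by (simp add: move_while_def)

lemma wf_com_clear: "wf_com n (clear X)"
  by (simp add: clear_def)

lemma wf_com_add: "X \<notin> {Tmp1, Tmp2, Carry} \<Longrightarrow> Y \<notin> {Tmp1, Tmp2, Carry} \<Longrightarrow> 2 < n \<Longrightarrow> wf_com n (add X Y)"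
  by (auto simp: add_def add_loop_def wf_com_move_while sum_bit_def carry_bit_def bit_sym_def)

lemma wf_com_scale:
  "X \<notin> {Tmp1, Tmp2, Carry} \<Longrightarrow> Y \<notin> {Tmp1, Tmp2, Carry} \<Longrightarrow> 2 < n \<Longrightarrow> wf_com n (scale X Y)"
  by (auto simp: scale_def skip_def intro: wf_com_add)

lemma wf_com_check_com: "2 < n \<Longrightarrow> wf_com n check_com"
  by (simp add: check_com_def rows_com_def row_com_def entries_def entry_def compare_def replace_def
      digit_loop_def scale_sums_def skip_def wf_com_move_while wf_com_clear wf_com_add wf_com_scale)

lemma wf_com_copy_com: "wf_com n copy_com"
  by (simp add: copy_com_def wf_com_move_while)

text \<open>The assumed machine is understood only from its exact initial tapes, so the stack on its
  input tape must determine every cell and the head position.\<close>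

lemma holds_stack_unique:
  assumes "holds_stack (Some L) T w" "holds_stack (Some L) T' w"
  shows "T = T'"
proof -
  obtain t h t' h' where T: "T = (t, h)" "T' = (t', h')" by force
  have h: "h' = h" "h + int (length w) = L" using assms by (auto simp: holds_stack_def T)
  have "t z = t' z" for z
  proof (cases "h \<le> z \<and> z < L")
    case True
    then have "nat (z - h) < length w" "z = h + int (nat (z - h))" using h by auto
    moreover have "t (h + int j) = w ! j \<and> t' (h + int j) = w ! j" if "j < length w" for j
      using assms h that by (simp add: holds_stack_def T)
    ultimately show ?thesis by metis
  next
    case False
    then show ?thesis using assms h by (auto simp: holds_stack_def T)
  qed
  then show ?thesis using h T by auto
qed

lemma holds_stack_blank: "holds_stack (Some 0) blank_tape []"
  by (simp add: holds_stack_def blank_tape_def)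

lemma holds_stack_input: "0 \<notin> set w \<Longrightarrow> holds_stack (Some (int (length w))) (input_tape w) w"
  by (auto simp: holds_stack_def input_tape_def in_set_conv_nth)

lemma holds_stack_None: "holds_stack E T w \<Longrightarrow> holds_stack None T w"
  by (simp add: holds_stack_def)

lemma tm_outputs_within_iff:
  "tm_outputs_within M w t v \<longleftrightarrow>
    (\<exists>ts. runs M t (input_tape w # replicate (num_tapes M - 1) blank_tape) ts \<and> tape_output (last ts) v)"
  by (auto simp: tm_outputs_within_def runs_iff init_config_def)

lemma tm_outputs_within_mono: "tm_outputs_within M w t v \<Longrightarrow> t \<le> t' \<Longrightarrow> tm_outputs_within M w t' v"
  unfolding tm_outputs_within_iff using runs_mono by blast

text \<open>Tapes \<open>0, \<dots>, l - 1\<close> are those of \<open>M\<close>, the others belong to the registers except \<open>In\<close>.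
  Register \<open>In\<close> is the input tape of \<open>M\<close> before \<open>M\<close> is run, and its output tape afterwards.\<close>

definition decider :: "tm \<Rightarrow> tm" where
  "decider M = (let l = num_tapes M; k = l + 16; n = max (num_symbols M) 7 in
     seq_tm (compile k n (\<lambda>r. if r = In then 0 else l - 1 + reg_index r) copy_com)
       (seq_tm (lift_tm k n M) (compile k n (\<lambda>r. l - 1 + reg_index r) check_com)))"

lemma reg_tapes:
  assumes "0 < l"
  shows "(if r = In then 0 else l - 1 + reg_index r) < l + 16" "l - 1 + reg_index r < l + 16"
    "inj (\<lambda>r. if r = In then 0 else l - 1 + reg_index r)" "inj (\<lambda>r. l - 1 + reg_index r)"
proof -
  have pos: "0 < l - 1 + reg_index r" if "r \<noteq> In" for r
    using reg_index_eq_0 [of r] that by simp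
  show "inj (\<lambda>r. if r = In then 0 else l - 1 + reg_index r)"
  proof (rule injI)
    fix r r' assume "(if r = In then 0 else l - 1 + reg_index r) = (if r' = In then 0 else l - 1 + reg_index r')"
    then show "r = r'" using pos [of r] pos [of r'] inj_reg_index by (auto split: if_splits)
  qed
qed (use assms reg_index_le [of r] inj_reg_index in \<open>auto simp: inj_def\<close>)

lemma fits_decider:
  assumes "wf_tm M"
  shows "fits (num_tapes M + 16) (max (num_symbols M) 7) (decider M)"
proof -
  have M: "fits (num_tapes M) (num_symbols M) M" using assms by (simp add: fits_def)
  note tapes = reg_tapes(1,2) [OF fitsD(2) [OF M]]
  show ?thesis
    unfolding decider_def Let_def
    by (intro fits_seq_tm fits_lift_tm [OF M] fits_compile tapes wf_com_check_com wf_com_copy_com) auto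
qed

text \<open>Copying takes \<open>18 * length w + 3\<close> steps; the two compositions account for
  the other 2.\<close>

lemma decider_outputs:
  assumes M: "wf_tm M"
    and w: "set w \<subseteq> {0<..<num_symbols M}"
    and out: "tm_outputs_within M w t v"
    and check: "exec check_com ((\<lambda>_. [])(In := v, Src := w)) t' s'"
  shows "tm_outputs_within (decider M) w (18 * length w + 5 + t + t') (s' Out)"
proof -
  define n where "n = max (num_symbols M) 7"
  define k where "k = num_tapes M + 16"
  define N where "N = decider M"
  define l where "l = num_tapes M"
  define m where "m = num_symbols M"
  define \<rho>1 where "\<rho>1 = (\<lambda>r. if r = In then 0 else l - 1 + reg_index r)"
  define \<rho>2 where "\<rho>2 = (\<lambda>r. l - 1 + reg_index r)"
  have fM: "fits l m M" using M by (simp add: fits_def l_def m_def)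
  have l: "0 < l" "k = l + 16" using fitsD [OF fM] by (simp_all add: k_def l_def)
  have n: "m \<le> n" "7 \<le> n" "0 < n" by (auto simp: n_def m_def)
  have r1: "\<rho>1 r < k" "inj \<rho>1" and r2: "\<rho>2 r < k" "inj \<rho>2" for r
    using reg_tapes [OF l(1)] by (simp_all add: \<rho>1_def \<rho>2_def l(2))
  define C1 where "C1 = compile k n \<rho>1 copy_com"
  define C2 where "C2 = compile k n \<rho>2 check_com"
  define LM where "LM = lift_tm k n M"
  have N: "N = seq_tm C1 (seq_tm LM C2)"
    unfolding N_def decider_def Let_def n_def k_def C1_def C2_def LM_def \<rho>1_def \<rho>2_def l_def ..
  have f: "fits k n C1" "fits k n C2" "fits k n LM"
    unfolding C1_def C2_def LM_def
    using fits_compile [OF n(3), of \<rho>1 k copy_com] fits_compile [OF n(3), of \<rho>2 k check_com] r1(1) r2(1)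
      wf_com_check_com wf_com_copy_com n fits_lift_tm [OF fM] l by auto
  have fN: "fits k n N" unfolding N by (intro fits_seq_tm f)
  have w0: "0 \<notin> set w" using w by auto
  define ts0 where "ts0 = input_tape w # replicate (k - 1) blank_tape"
  have sym: "fst (input_tape w) z < m" for z
  proof -
    have "w ! nat z < m" if "0 \<le> z" "z < int (length w)"
    proof -
      have "w ! nat z \<in> set w" using that by simp
      then show ?thesis using w by (auto simp: m_def)
    qed
    then show ?thesis using fitsD(3) [OF fM] by (auto simp: input_tape_def)
  qed
  have v0: "valid_tapes k n ts0"
    using sym n l order_less_le_trans [OF sym n(1)] by (auto simp: valid_tapes_def ts0_def blank_tape_def)
  \<comment> \<open>The input ends at cell \<open>length w\<close>; all other stacks start empty at
    cell 0.\<close>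
  define E where "E = (\<lambda>r. Some (if r = In then int (length w) else 0))"
  have "holds_stack (E r) (ts0 ! \<rho>1 r) (((\<lambda>_. [])(In := w)) r)" for r
  proof (cases "r = In")
    case True
    then show ?thesis using holds_stack_input [OF w0] by (simp add: E_def ts0_def \<rho>1_def)
  next
    case False
    then have "ts0 ! \<rho>1 r = blank_tape"
      using reg_index_eq_0 [of r] r1(1) [of r] by (auto simp: ts0_def \<rho>1_def nth_Cons')
    then show ?thesis using False holds_stack_blank by (simp add: E_def)
  qed
  from compile_correct [OF exec_copy_com [OF w0] n(3) r1 wf_com_copy_com v0 this, folded C1_def]
  obtain ts1 where ts1: "runs C1 (18 * length w + 3) ts0 ts1"
    "\<forall>r. holds_stack (E r) (ts1 ! \<rho>1 r) (((\<lambda>_. [])(In := w, Src := w)) r)"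
    "\<forall>j. j \<notin> range \<rho>1 \<longrightarrow> ts1 ! j = ts0 ! j" by blast
  have v1: "valid_tapes k n ts1" using runs_valid [OF f(1) v0 ts1(1)] .
  have len1: "length ts1 = k" using v1 by (simp add: valid_tapes_def)
  define us where "us = input_tape w # replicate (l - 1) blank_tape"
  \<comment> \<open>Equality of tapes is needed here: the assumed machine has to behave as if
    started alone.\<close>
  have take: "take l ts1 = us"
  proof (rule nth_equalityI)
    fix j assume "j < length (take l ts1)"
    then have j: "j < l" "j < k" using len1 by auto
    show "take l ts1 ! j = us ! j"
    proof (cases "j = 0")
      case True
      have "holds_stack (Some (int (length w))) (ts1 ! 0) w"
        using ts1(2) [rule_format, of In] by (simp add: E_def \<rho>1_def)
      then show ?thesis using holds_stack_unique holds_stack_input [OF w0] True j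
        by (auto simp: us_def)
    next
      case False
      \<comment> \<open>The tapes 1 to \<open>l - 1\<close> carry no register during the copying, so
        they are still blank.\<close>
      have "j \<noteq> \<rho>1 r" for r
        using False j reg_index_eq_0 [of r] l by (auto simp: \<rho>1_def)
      then have "ts1 ! j = ts0 ! j" using ts1(3) by blast
      then show ?thesis using False j by (auto simp: ts0_def us_def nth_Cons')
    qed
  qed (use len1 l in \<open>simp add: us_def\<close>)
  have vu: "valid_tapes l m us"
    using sym fitsD [OF fM] by (auto simp: valid_tapes_def us_def blank_tape_def)
  obtain us' where us': "runs M t us us'" "tape_output (last us') v"
    using out unfolding tm_outputs_within_iff us_def l_def by blast
  have vu': "valid_tapes l m us'" using runs_valid [OF fM vu us'(1)] .
  then have lu': "length us' = l" by (simp add: valid_tapes_def)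
  define ts2 where "ts2 = us' @ drop l ts1"
  have run2: "runs LM t ts1 ts2"
    using runs_lift_tm [OF fM vu us'(1), of k n "drop l ts1"] take append_take_drop_id [of l ts1]
    by (simp add: LM_def ts2_def)
  have v2: "valid_tapes k n ts2" using runs_valid [OF f(3) v1 run2] .
  \<comment> \<open>\<open>In\<close> now lies on the output tape of the assumed machine, whose
    contents beyond the answer are unknown, so only the loose form is available. Apart from
    \<open>In\<close> and \<open>Src\<close> all registers are empty after the copying.\<close>
  have "holds_stack None (ts2 ! \<rho>2 r) (((\<lambda>_. [])(In := v, Src := w)) r)" for r
  proof (cases "r = In")
    case True
    have "us' \<noteq> []" using lu' l by auto
    then have "ts2 ! \<rho>2 r = last us'"
      using True l lu' by (simp add: ts2_def \<rho>2_def reg_index_def nth_append last_conv_nth)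
    then show ?thesis using us'(2) True by (simp add: holds_stack_def)
  next
    case False
    have ge: "l \<le> \<rho>2 r" using reg_index_eq_0 [of r] False l by (auto simp: \<rho>2_def)
    have "ts2 ! \<rho>2 r = drop l ts1 ! (\<rho>2 r - l)" using ge lu' by (simp add: ts2_def nth_append)
    also have "\<dots> = ts1 ! \<rho>2 r" using ge len1 l by simp
    finally have "ts2 ! \<rho>2 r = ts1 ! \<rho>1 r" using False by (simp add: \<rho>1_def \<rho>2_def)
    moreover have "holds_stack None (ts1 ! \<rho>1 r) (((\<lambda>_. [])(In := w, Src := w)) r)"
      using ts1(2) holds_stack_None by blast
    ultimately show ?thesis using False by (cases "r = Src") auto
  qed
  from compile_correct [OF check n(3) r2 wf_com_check_com v2 this, folded C2_def] n
  obtain ts3 where ts3: "runs C2 t' ts2 ts3" "\<forall>r. holds_stack None (ts3 ! \<rho>2 r) (s' r)" by auto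
  have v3: "valid_tapes k n ts3" using runs_valid [OF f(2) v2 ts3(1)] .
  then have "length ts3 = k" "ts3 \<noteq> []" using l by (auto simp: valid_tapes_def)
  then have "last ts3 = ts3 ! (k - 1)" by (simp add: last_conv_nth)
  moreover have "\<rho>2 Out = k - 1" using l by (simp add: \<rho>2_def reg_index_def)
  ultimately have last: "tape_output (last ts3) (s' Out)"
    using ts3(2) [rule_format, of Out] by (simp add: holds_stack_def)
  have "runs N (18 * length w + 3 + (t + t' + 1) + 1) ts0 ts3"
    unfolding N
    by (rule runs_seq_tm [OF f(1) fits_seq_tm [OF f(3,2)] v0 ts1(1) runs_seq_tm [OF f(3,2) v1 run2 ts3(1)]])
  then have "runs N (18 * length w + 5 + t + t') ts0 ts3" by (simp add: add.commute add.left_commute)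
  moreover have "num_tapes N = k" using fitsD(1) [OF fN] .
  ultimately show ?thesis
    using last unfolding tm_outputs_within_iff N_def [symmetric] ts0_def by auto
qed

section \<open>Symbols and lengths of the encodings\<close>

lemma enc_nat_symbols: "set (enc_nat n) \<subseteq> {1, 2}"
  using enc_nat_digits [of n] by (simp add: digits_def)

lemma enc_market_symbols: "set (enc_market I) \<subseteq> {1..5}"
proof -
  have "x \<in> {1..5}" if "x \<in> set (enc_nat n)" for x n
    using enc_nat_symbols [of n] that by auto
  then show ?thesis by (auto simp: enc_market_def enc_rat_def split: prod.splits)
qed

lemma enc_assignment_symbols: "set (enc_assignment I p) \<subseteq> {1..5}"
  by (auto simp: enc_assignment_def enc_bool_def)

text \<open>The length depends on the market alone, so the answer is encoded in the same length as
  the given assignment and is bounded by the length of the input.\<close>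

lemma length_enc_assignment: "length (enc_assignment I p) = num_agents I * (num_objects I + 1)"
proof -
  have "length (concat (map (\<lambda>j. enc_bool (j \<in> p i)) js)) = length js" for i js
    by (induction js) (auto simp: enc_bool_def)
  then show ?thesis
    by (simp add: enc_assignment_def length_concat comp_def sum_list_triv del: upt_Suc)
qed

theorem lemma1:
  assumes "poly_time_computable instances enc_instance
             (\<lambda>(I, e) q. enc_assignment I q)
             (\<lambda>(I, e) q. assignment I q \<and> pareto_optimal I q \<and> individually_rational I e q)"
  shows "poly_time_decidable instances enc_instance (\<lambda>(I, p). pareto_optimal I p)"
proof -
  from assms obtain M :: tm and b :: "nat poly" where M: "wf_tm M"
    and alg: "\<forall>x\<in>instances. set (enc_instance x) \<subseteq> {0<..<num_symbols M} \<and>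
      (\<exists>q. (case x of (I, e) \<Rightarrow> \<lambda>q. assignment I q \<and> pareto_optimal I q \<and> individually_rational I e q) q \<and>
        tm_outputs_within M (enc_instance x) (poly b (length (enc_instance x)))
          ((case x of (I, e) \<Rightarrow> enc_assignment I) q))"
    unfolding poly_time_computable_def by blast
  \<comment> \<open>600 of the 700 bound the check; the remaining 100 cover the linear time for
    copying.\<close>
  define b' where "b' = b + smult 700 ([:1, 1:] ^ 2)"
  have "\<exists>y. (y \<longleftrightarrow> pareto_optimal I p) \<and> set (enc_instance (I, p)) \<subseteq> {0<..<num_symbols (decider M)} \<and>
      tm_outputs_within (decider M) (enc_instance (I, p)) (poly b' (length (enc_instance (I, p)))) (enc_bool y)"
    if Ip: "wf_market I" "assignment I p" for I p
  proof -
    define w where "w = enc_instance (I, p)"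
    have "(I, p) \<in> instances" using Ip by (simp add: instances_def)
    from bspec [OF alg this] obtain q
      where q: "assignment I q" "pareto_optimal I q" "individually_rational I p q"
        "tm_outputs_within M w (poly b (length w)) (enc_assignment I q)"
      and w: "set w \<subseteq> {0<..<num_symbols M}"
      unfolding w_def by auto
    have weq: "w = enc_market I @ 6 # enc_assignment I p" by (simp add: w_def enc_instance_def)
    have syms: "0 \<notin> set (enc_market I)" "6 \<notin> set (enc_market I)" "0 \<notin> set (enc_assignment I p)"
      "0 \<notin> set (enc_assignment I q)"
      using enc_market_symbols [of I] enc_assignment_symbols [of I] by fastforce+
    have lens: "length (enc_market I) + 1 + length (enc_assignment I p) \<le> length w"
      "length (enc_assignment I q) \<le> length w"
      by (simp_all add: weq length_enc_assignment)
    have "\<forall>es\<in>set (rows_of I p q). good_row es" using good_rows_of by blast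
    from exec_check_com [OF rev_enc_market rev_enc_assignment this syms lens]
    obtain s' where s':
      "exec check_com ((\<lambda>_. [])(In := enc_assignment I q, Src := w)) (600 * (length w + 1) ^ 2) s'"
      "s' Out = enc_bool (\<forall>es\<in>set (rows_of I p q). balanced es)"
      unfolding weq by blast
    have "(\<forall>es\<in>set (rows_of I p q). balanced es) \<longleftrightarrow> (\<forall>i\<in>agents I. balanced (row_of I p q i))"
      by (auto simp: rows_of_def agents_def)
    also have "\<dots> \<longleftrightarrow> pareto_optimal I p"
      using balanced_row_of [OF Ip q(1)] pareto_optimal_iff_indifferent [OF q(1-3)] by simp
    finally have ans: "s' Out = enc_bool (pareto_optimal I p)" using s'(2) by simp
    have "18 * length w + 5 + poly b (length w) + 600 * (length w + 1) ^ 2 \<le> poly b' (length w)"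
      by (simp add: b'_def power2_eq_square algebra_simps)
    then have "tm_outputs_within (decider M) w (poly b' (length w)) (enc_bool (pareto_optimal I p))"
      using decider_outputs [OF M w q(4) s'(1)] ans tm_outputs_within_mono by simp
    moreover have "set w \<subseteq> {0<..<num_symbols (decider M)}"
      using w unfolding fitsD(6) [OF fits_decider [OF M]] by (rule order_trans) auto
    ultimately show ?thesis unfolding w_def by blast
  qed
  moreover have "wf_tm (decider M)" using fits_decider [OF M] by (simp add: fits_def)
  ultimately show ?thesis
    unfolding poly_time_decidable_def poly_time_computable_def instances_def
    by (intro exI [of _ "decider M"] exI [of _ b'] conjI) blast+
qed

end
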